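(* Let $K$ be a field of characteristic zero, let $f\in K[x_1,\dots,x_n]$ be a nonzero polynomial, and let $b\in\mathbb Q[s]$ be a nonzero polynomial. Let $E_b\subset K[x]$ be the ideal computed as follows. 1. Let $G\subset K[x,s]$ be a set of generators of the ideal $\operatorname{in}_{(-w,w)}I_f\cap K[x,s]$, where $s=-\partial_t t$. 2. Let $G_1$ be a Gröbner basis of the ideal $\langle G\rangle\subset K[x,s]$ with respect to a monomial order eliminating $s$. Let $d=\deg b$ and $G_2=\{s^i g\mid g\in G_1,\ i\ge 0,\ i+\deg_s g\le d\}$. 3. Let $S$ be the kernel of the $K[x]$-linear map $\varphi:K[x]^{|G_2|+1}\to\bigoplus_{i=0}^d K[x]s^i$ that sends the first $|G_2|$ standard basis vectors to the elements of $G_2$ and the last one to $b$. Let $E_b$ be the projection of $S$ onto the last coordinate. Then for every prime ideal $P\in\operatorname{Spec}K[x]$, $$b_{f,P}\mid b\iff E_b\not\subset P,$$ where $b_{f,P}$ is the local Bernstein--Sato polynomial of $f$ at $P$.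
   Context: $D_X=K\langle x_1,\dots,x_n,\partial_{x_1},\dots,\partial_{x_n}\rangle$ is the $n$-th Weyl algebra and $D_Y=K\langle x_1,\dots,x_n,t,\partial_{x_1},\dots,\partial_{x_n},\partial_t\rangle$ is the Weyl algebra in the variables $x_1,\dots,x_n,t$; $K[x]=K[x_1,\dots,x_n]$. $D_X[s]$ ($s$ central) acts on the free rank-one module $K[x][f^{-1},s]f^s$ with $x_i$ acting by multiplication and $\partial_{x_i}\cdot f^s=s\frac{\partial f}{\partial x_i}f^{-1}f^s$. Write $f^{s+1}=f\cdot f^s$. For a prime ideal $P\subset K[x]$, the local Bernstein--Sato polynomial $b_{f,P}$ is the monic polynomial $b(s)$ of minimal degree such that $Q'f^{s+1}=b(s)f^s$ for some $Q'\in K[x]_P\otimes_{K[x]}D_X[s]$, where $K[x]_P$ is the localization of $K[x]$ at $P$. $I_f\subset D_Y$ is the left ideal generated by $t-f$ and $\partial_{x_i}+\frac{\partial f}{\partial x_i}\partial_t$ for $i=1,\dots,n$. $w=(\mathbf 0,1)\in\mathbb R^n\times\mathbb R$, and the weight $(-w,w)$ on $D_Y$ gives $x_i,\partial_{x_i}$ weight $0$, $t$ weight $-1$, and $\partial_t$ weight $1$. For nonzero $R\in D_Y$, $\operatorname{in}_{(-w,w)}(R)$ is the sum of the terms of $R$ of highest weight (viewed in $\operatorname{gr}_{(-w,w)}D_Y\cong D_Y$), and $\operatorname{in}_{(-w,w)}I_f$ is the left ideal of $D_Y$ generated by the $\operatorname{in}_{(-w,w)}(R)$ with $0\ne R\in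 I_f$. Setting $s=-\partial_t t$ identifies $K[x,s]$ with a commutative subring of $D_Y$. *)

theory Defs
  imports
    Complex_Main
    "HOL-Library.Poly_Mapping"
    "HOL-Library.Product_Plus"
    "HOL-Library.Option_ord"
    "HOL-Library.FuncSet"
    "HOL-Computational_Algebra.Polynomial"
    "HOL-Computational_Algebra.Fraction_Field"
begin

subsection \<open>Additive extension from monomials\<close>

definition pm_extend :: "('a \<Rightarrow> 'b \<Rightarrow> 'c) \<Rightarrow> ('a \<Rightarrow>\<^sub>0 'b::zero) \<Rightarrow> 'c::comm_monoid_add"
  where "pm_extend h p = (\<Sum>m\<in>Poly_Mapping.keys p. h m (Poly_Mapping.lookup p m))"

lemma pm_extend_zero [simp]: "pm_extend h 0 = 0"
  by (simp add: pm_extend_def)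

lemma pm_extend_single: "h m 0 = 0 \<Longrightarrow> pm_extend h (Poly_Mapping.single m c) = h m c"
  by (simp add: pm_extend_def)

lemma pm_extend_add:
  assumes "\<And>m. h m 0 = 0" "\<And>m x y. h m (x + y) = h m x + h m y"
  shows "pm_extend h (p + q) = pm_extend h p + pm_extend h q"
  unfolding pm_extend_def by (rule setsum_keys_plus_distrib) (use assms in auto)

lemma pm_extend_add_fun: "pm_extend (\<lambda>m x. h m x + k m x) p = pm_extend h p + pm_extend k p"
  by (simp add: pm_extend_def sum.distrib)

lemma pm_extend_zero_fun [simp]: "pm_extend (\<lambda>m x. 0) p = 0"
  by (simp add: pm_extend_def)

lemma pm_induct [case_names single add]:
  fixes p :: "'a \<Rightarrow>\<^sub>0 'b::comm_monoid_add"
  assumes single: "\<And>m c. Q (Poly_Mapping.single m c)"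
    and add: "\<And>p q. Q p \<Longrightarrow> Q q \<Longrightarrow> Q (p + q)"
  shows "Q p"
proof (induction p rule: update_induct)
  case const
  then show ?case using single[of undefined 0] by simp
next
  case (update p m c)
  have "Poly_Mapping.update m c p = p + Poly_Mapping.single m c"
    using update(1)
    by (intro poly_mapping_eqI)
       (auto simp: lookup_update lookup_add lookup_single in_keys_iff when_def)
  then show ?case using add[OF update(3) single] by simp
qed


subsection \<open>The polynomial ring \<open>K[x]\<close>\<close>

text \<open>
  The variables are indexed by a finite type \<open>'n\<close>. Where \<open>'n\<close> is also linearly ordered,
  this is only because the library proves \<open>K[x]\<close> to be an integral domain under that
  assumption.
\<close>

type_synonym ('k, 'n) mpoly = "('n \<Rightarrow>\<^sub>0 nat) \<Rightarrow>\<^sub>0 'k"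

definition pdiff :: "'n \<Rightarrow> ('k::comm_ring_1, 'n) mpoly \<Rightarrow> ('k, 'n) mpoly"
  where "pdiff i = pm_extend (\<lambda>m c.
    Poly_Mapping.single (m - Poly_Mapping.single i 1) (of_nat (Poly_Mapping.lookup m i) * c))"

lemma pdiff_single:
  "pdiff i (Poly_Mapping.single m c) =
     Poly_Mapping.single (m - Poly_Mapping.single i 1) (of_nat (Poly_Mapping.lookup m i) * c)"
  unfolding pdiff_def by (subst pm_extend_single) simp_all

lemma pdiff_add: "pdiff i (p + q) = pdiff i p + pdiff i q"
  unfolding pdiff_def by (rule pm_extend_add) (simp_all add: distrib_left single_add)

lemma pdiff_mult: "pdiff i (p * q) = pdiff i p * q + p * pdiff i q"
proof (induction p rule: pm_induct)
  case (single m c)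
  show ?case
  proof (induction q rule: pm_induct)
    case (single n d)
    let ?e = "Poly_Mapping.single i (1::nat)"
    have shift: "u - ?e + v = u + v - ?e" if "Poly_Mapping.lookup u i \<noteq> 0" for u v
      using that
      by (intro poly_mapping_eqI) (auto simp: lookup_add lookup_minus lookup_single when_def)
    have m: "Poly_Mapping.single (m - ?e + n) (of_nat (Poly_Mapping.lookup m i) * c * d) =
      Poly_Mapping.single (m + n - ?e) (of_nat (Poly_Mapping.lookup m i) * c * d)"
      using shift[of m n] by (cases "Poly_Mapping.lookup m i = 0") auto
    have n: "Poly_Mapping.single (m + (n - ?e)) (c * (of_nat (Poly_Mapping.lookup n i) * d)) =
      Poly_Mapping.single (m + n - ?e) (c * (of_nat (Poly_Mapping.lookup n i) * d))"
      using shift[of n m] by (cases "Poly_Mapping.lookup n i = 0") (auto simp: add.commute)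
    show ?case
      unfolding mult_single pdiff_single m n single_add[symmetric]
      by (simp add: lookup_add algebra_simps)
  next
    case (add q r)
    then show ?case by (simp add: pdiff_add distrib_left)
  qed
next
  case (add p r)
  then show ?case by (simp add: pdiff_add distrib_right)
qed


subsection \<open>Weyl algebras\<close>

text \<open>
  An element of the Weyl algebra in the variables \<open>'v\<close> is stored by the coefficients of its
  normally ordered expression: the key \<open>(a, b)\<close> stands for the term \<open>x\<^sup>a \<partial>\<^sup>b\<close>.
  The product is determined by the Leibniz rule
  \<open>\<partial>\<^sup>b x\<^sup>c = (\<Sum>k\<le>b. k! binom(b,k) binom(c,k) x\<^sup>c\<^sup>-\<^sup>k \<partial>\<^sup>b\<^sup>-\<^sup>k)\<close> for multi-indices;
  note that the library order on \<open>'v \<Rightarrow>\<^sub>0 nat\<close> is lexicographic, so the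
  componentwise order is written out.
\<close>

definition below :: "('v \<Rightarrow>\<^sub>0 nat) \<Rightarrow> ('v \<Rightarrow>\<^sub>0 nat) set"
  where "below b = {k. \<forall>v. Poly_Mapping.lookup k v \<le> Poly_Mapping.lookup b v}"

definition leibniz :: "('v::finite \<Rightarrow>\<^sub>0 nat) \<Rightarrow> ('v \<Rightarrow>\<^sub>0 nat) \<Rightarrow> ('v \<Rightarrow>\<^sub>0 nat) \<Rightarrow> nat"
  where "leibniz b c k = (\<Prod>v\<in>UNIV. fact (Poly_Mapping.lookup k v)
    * (Poly_Mapping.lookup b v choose Poly_Mapping.lookup k v)
    * (Poly_Mapping.lookup c v choose Poly_Mapping.lookup k v))"

definition weyl_times_term ::
  "('v::finite \<Rightarrow>\<^sub>0 nat) \<times> ('v \<Rightarrow>\<^sub>0 nat) \<Rightarrow> ('v \<Rightarrow>\<^sub>0 nat) \<times> ('v \<Rightarrow>\<^sub>0 nat) \<Rightarrow> 'k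
    \<Rightarrow> (('v \<Rightarrow>\<^sub>0 nat) \<times> ('v \<Rightarrow>\<^sub>0 nat)) \<Rightarrow>\<^sub>0 'k::comm_ring_1"
  where "weyl_times_term m n x = (\<Sum>k\<in>below (snd m).
    Poly_Mapping.single (fst m + (fst n - k), (snd m - k) + snd n)
      (of_nat (leibniz (snd m) (fst n) k) * x))"

definition weyl_times ::
  "((('v::finite \<Rightarrow>\<^sub>0 nat) \<times> ('v \<Rightarrow>\<^sub>0 nat)) \<Rightarrow>\<^sub>0 'k::comm_ring_1)
    \<Rightarrow> ((('v \<Rightarrow>\<^sub>0 nat) \<times> ('v \<Rightarrow>\<^sub>0 nat)) \<Rightarrow>\<^sub>0 'k)
    \<Rightarrow> (('v \<Rightarrow>\<^sub>0 nat) \<times> ('v \<Rightarrow>\<^sub>0 nat)) \<Rightarrow>\<^sub>0 'k"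
  where "weyl_times P Q = pm_extend (\<lambda>m x. pm_extend (\<lambda>n y. weyl_times_term m n (x * y)) Q) P"

lemma weyl_times_term_zero [simp]: "weyl_times_term m n 0 = 0"
  by (simp add: weyl_times_term_def)

lemma weyl_times_term_add:
  "weyl_times_term m n (x + y) = weyl_times_term m n x + weyl_times_term m n y"
  by (simp add: weyl_times_term_def distrib_left single_add sum.distrib)

lemma weyl_times_add_left: "weyl_times (P + Q) R = weyl_times P R + weyl_times Q R"
  unfolding weyl_times_def
  by (rule pm_extend_add)
     (simp_all add: distrib_right weyl_times_term_add pm_extend_add_fun)

lemma weyl_times_add_right: "weyl_times P (Q + R) = weyl_times P Q + weyl_times P R"
  unfolding weyl_times_def pm_extend_add_fun[symmetric]
  by (subst pm_extend_add) (simp_all add: distrib_left weyl_times_term_add)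

lemma weyl_times_zero [simp]: "weyl_times 0 P = 0" "weyl_times P 0 = 0"
  by (simp_all add: weyl_times_def)

lemma weyl_times_single:
  "weyl_times (Poly_Mapping.single m x) (Poly_Mapping.single n y) = weyl_times_term m n (x * y)"
  unfolding weyl_times_def by (simp add: pm_extend_single)

text \<open>Associativity is obtained from the faithful action on polynomials.\<close>

definition falling :: "('v::finite \<Rightarrow>\<^sub>0 nat) \<Rightarrow> ('v \<Rightarrow>\<^sub>0 nat) \<Rightarrow> nat"
  where "falling e b = (\<Prod>v\<in>UNIV. fact (Poly_Mapping.lookup b v)
    * (Poly_Mapping.lookup e v choose Poly_Mapping.lookup b v))"

definition weyl_act ::
  "((('v::finite \<Rightarrow>\<^sub>0 nat) \<times> ('v \<Rightarrow>\<^sub>0 nat)) \<Rightarrow>\<^sub>0 'k::comm_ring_1) \<Rightarrow> ('k, 'v) mpoly \<Rightarrow> ('k, 'v) mpoly"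
  where "weyl_act P q = pm_extend (\<lambda>m x. pm_extend (\<lambda>e y.
    Poly_Mapping.single (fst m + (e - snd m)) (of_nat (falling e (snd m)) * (x * y))) q) P"

lemma weyl_act_add_left: "weyl_act (P + Q) q = weyl_act P q + weyl_act Q q"
  unfolding weyl_act_def
  by (rule pm_extend_add)
     (simp_all add: distrib_left distrib_right single_add pm_extend_add_fun)

lemma weyl_act_add_right: "weyl_act P (p + q) = weyl_act P p + weyl_act P q"
  unfolding weyl_act_def pm_extend_add_fun[symmetric]
  by (subst pm_extend_add) (simp_all add: distrib_left single_add)

lemma weyl_act_zero [simp]: "weyl_act 0 q = 0" "weyl_act P 0 = 0"
  by (simp_all add: weyl_act_def)

lemma weyl_act_single:
  "weyl_act (Poly_Mapping.single m x) (Poly_Mapping.single e y) =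
     Poly_Mapping.single (fst m + (e - snd m)) (of_nat (falling e (snd m)) * (x * y))"
  unfolding weyl_act_def by (simp add: pm_extend_single)

lemma weyl_act_sum: "weyl_act (sum F A) q = (\<Sum>a\<in>A. weyl_act (F a) q)"
  by (induction A rule: infinite_finite_induct) (simp_all add: weyl_act_add_left)

lemma falling_leibniz_1:
  "(fact d * (e choose d)) * (fact b * ((c + (e - d)) choose b)) =
     (\<Sum>k\<le>b. (fact k * (b choose k) * (c choose k)) * (fact (b - k + d) * (e choose (b - k + d))) :: nat)"
proof (cases "d \<le> e")
  case False
  then show ?thesis by (simp add: binomial_eq_0)
next
  case True
  have ff: "fact (j + d) * (e choose (j + d)) = (fact d * (e choose d)) * (fact j * ((e - d) choose j))"
    for j :: nat
  proof (cases "j + d \<le> e")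
    case le: True
    have "fact (e - d - j) * (fact (j + d) * (e choose (j + d))) = fact e"
      using binomial_fact_lemma[OF le] by (simp add: algebra_simps diff_diff_left)
    moreover have "fact (e - d - j) * ((fact d * (e choose d)) * (fact j * ((e - d) choose j))) =
        (fact d * (e choose d)) * (fact j * fact (e - d - j) * ((e - d) choose j))"
      by (simp add: algebra_simps)
    moreover have "fact j * fact (e - d - j) * ((e - d) choose j) = (fact (e - d) :: nat)"
      using le by (intro binomial_fact_lemma) simp
    moreover have "(fact d * (e choose d)) * fact (e - d) = (fact e :: nat)"
      using binomial_fact_lemma[OF True] by (simp add: algebra_simps)
    ultimately have "fact (e - d - j) * (fact (j + d) * (e choose (j + d))) =
       fact (e - d - j) * ((fact d * (e choose d)) * (fact j * ((e - d) choose j)))"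
      by argo
    then show ?thesis by simp
  next
    case False
    then have "e < j + d" "e - d < j" using True by linarith+
    then show ?thesis by (simp add: binomial_eq_0)
  qed
  have "(\<Sum>k\<le>b. (fact k * (b choose k) * (c choose k)) * (fact (b - k + d) * (e choose (b - k + d)))) =
     (\<Sum>k\<le>b. (fact d * (e choose d)) * (fact b * ((c choose k) * ((e - d) choose (b - k)))))"
  proof (rule sum.cong[OF refl])
    fix k assume "k \<in> {..b}"
    then have "fact k * fact (b - k) * (b choose k) = (fact b :: nat)"
      by (intro binomial_fact_lemma) simp
    then show "(fact k * (b choose k) * (c choose k)) * (fact (b - k + d) * (e choose (b - k + d))) =
      (fact d * (e choose d)) * (fact b * ((c choose k) * ((e - d) choose (b - k))))"
      unfolding ff by (simp add: mult_ac flip: \<open>_ = fact b\<close>)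
  qed
  also have "\<dots> = (fact d * (e choose d)) * (fact b * ((c + (e - d)) choose b))"
    by (simp only: sum_distrib_left[symmetric] vandermonde)
  finally show ?thesis ..
qed

lemma bij_betw_below:
  fixes b :: "'v::finite \<Rightarrow>\<^sub>0 nat"
  shows "bij_betw Poly_Mapping.lookup (below b) (PiE UNIV (\<lambda>v. {..Poly_Mapping.lookup b v}))"
proof (rule bij_betwI[where g = Abs_poly_mapping])
  show "Poly_Mapping.lookup \<in> below b \<rightarrow> PiE UNIV (\<lambda>v. {..Poly_Mapping.lookup b v})"
    by (auto simp: below_def)
  show "Abs_poly_mapping \<in> PiE UNIV (\<lambda>v. {..Poly_Mapping.lookup b v}) \<rightarrow> below b"
    by (auto simp: below_def PiE_UNIV_domain)
qed (simp_all add: Poly_Mapping.lookup_inverse)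

lemma finite_below [simp]: "finite (below (b :: 'v::finite \<Rightarrow>\<^sub>0 nat))"
  using bij_betw_finite[OF bij_betw_below[of b]] by (simp add: finite_PiE)

lemma falling_leibniz:
  fixes b c d e :: "'v::finite \<Rightarrow>\<^sub>0 nat"
  shows "falling e d * falling (c + (e - d)) b =
    (\<Sum>k\<in>below b. leibniz b c k * falling e (b - k + d))"
proof -
  have "falling e d * falling (c + (e - d)) b = (\<Prod>v\<in>UNIV. \<Sum>k\<le>Poly_Mapping.lookup b v.
      (fact k * (Poly_Mapping.lookup b v choose k) * (Poly_Mapping.lookup c v choose k)) *
      (fact (Poly_Mapping.lookup b v - k + Poly_Mapping.lookup d v)
        * (Poly_Mapping.lookup e v choose (Poly_Mapping.lookup b v - k + Poly_Mapping.lookup d v))))"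
    unfolding falling_def prod.distrib[symmetric] lookup_add lookup_minus falling_leibniz_1 ..
  also have "\<dots> = (\<Sum>g\<in>PiE UNIV (\<lambda>v. {..Poly_Mapping.lookup b v}). \<Prod>v\<in>UNIV.
      (fact (g v) * (Poly_Mapping.lookup b v choose g v) * (Poly_Mapping.lookup c v choose g v)) *
      (fact (Poly_Mapping.lookup b v - g v + Poly_Mapping.lookup d v)
        * (Poly_Mapping.lookup e v choose (Poly_Mapping.lookup b v - g v + Poly_Mapping.lookup d v))))"
    by (rule prod_sum_PiE) auto
  also have "\<dots> = (\<Sum>k\<in>below b. leibniz b c k * falling e (b - k + d))"
    unfolding leibniz_def falling_def prod.distrib[symmetric] lookup_add lookup_minus
    by (rule sum.reindex_bij_betw[OF bij_betw_below, symmetric])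
  finally show ?thesis .
qed

lemma falling_nonzero_iff:
  "falling e b \<noteq> 0 \<longleftrightarrow> (\<forall>v. Poly_Mapping.lookup b v \<le> Poly_Mapping.lookup e v)"
  by (auto simp: falling_def not_less binomial_eq_0_iff)

lemma leibniz_zero: "leibniz b c k = 0 \<or> k \<in> below c"
  by (auto simp: leibniz_def below_def binomial_eq_0_iff not_less)

lemma sum_single: "(\<Sum>k\<in>A. Poly_Mapping.single m (F k)) = Poly_Mapping.single m (sum F A)"
  by (induction A rule: infinite_finite_induct) (simp_all add: single_add)

lemma weyl_act_times: "weyl_act (weyl_times P Q) q = weyl_act P (weyl_act Q q)"
proof (induction P rule: pm_induct)
  case (add P R)
  then show ?case by (simp add: weyl_times_add_left weyl_act_add_left)
next
  case (single m x)
  show ?case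
  proof (induction Q rule: pm_induct)
    case (add Q R)
    then show ?case by (simp add: weyl_times_add_right weyl_act_add_left weyl_act_add_right)
  next
    case (single n y)
    show ?case
    proof (induction q rule: pm_induct)
      case (add p q)
      then show ?case by (simp add: weyl_act_add_right)
    next
      case (single e z)
      obtain a b c d where [simp]: "m = (a, b)" "n = (c, d)" by (cases m, cases n)
      let ?L = "\<lambda>k. leibniz b c k * falling e (b - k + d)"
      have "weyl_act (weyl_times (Poly_Mapping.single m x) (Poly_Mapping.single n y))
              (Poly_Mapping.single e z) =
        (\<Sum>k\<in>below b. Poly_Mapping.single (a + (c - k) + (e - (b - k + d)))
           (of_nat (?L k) * (x * y * z)))"
        by (simp add: weyl_times_single weyl_times_term_def weyl_act_sum weyl_act_single mult_ac)
      also have "\<dots> = (\<Sum>k\<in>below b. Poly_Mapping.single (a + (c + (e - d) - b))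
           (of_nat (?L k) * (x * y * z)))"
      proof (rule sum.cong[OF refl])
        fix k assume k: "k \<in> below b"
        show "Poly_Mapping.single (a + (c - k) + (e - (b - k + d))) (of_nat (?L k) * (x * y * z)) =
          Poly_Mapping.single (a + (c + (e - d) - b)) (of_nat (?L k) * (x * y * z))"
        proof (cases "?L k = 0")
          case False
          then have "k \<in> below c" and f: "falling e (b - k + d) \<noteq> 0"
            using leibniz_zero[of b c k] by auto
          have "a + (c - k) + (e - (b - k + d)) = a + (c + (e - d) - b)"
          proof (rule poly_mapping_eqI)
            fix v
            have "Poly_Mapping.lookup k v \<le> Poly_Mapping.lookup c v"
              "Poly_Mapping.lookup k v \<le> Poly_Mapping.lookup b v"
              "Poly_Mapping.lookup b v - Poly_Mapping.lookup k v + Poly_Mapping.lookup d v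
                \<le> Poly_Mapping.lookup e v"
              using k \<open>k \<in> below c\<close> f
              unfolding below_def falling_nonzero_iff lookup_add lookup_minus by blast+
            then show "Poly_Mapping.lookup (a + (c - k) + (e - (b - k + d))) v =
              Poly_Mapping.lookup (a + (c + (e - d) - b)) v"
              unfolding lookup_add lookup_minus by linarith
          qed
          then show ?thesis by simp
        next
          case True
          then show ?thesis by (simp only: of_nat_0 mult_zero_left single_zero)
        qed
      qed
      also have "\<dots> = Poly_Mapping.single (a + (c + (e - d) - b))
          (of_nat (falling e d * falling (c + (e - d)) b) * (x * y * z))"
        by (simp only: sum_single falling_leibniz of_nat_sum sum_distrib_right)
      also have "\<dots> = weyl_act (Poly_Mapping.single m x)
          (weyl_act (Poly_Mapping.single n y) (Poly_Mapping.single e z))"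
        by (simp add: weyl_act_single mult_ac)
      finally show ?case .
    qed
  qed
qed

lemma weyl_act_faithful:
  fixes P :: "(('v::finite \<Rightarrow>\<^sub>0 nat) \<times> ('v \<Rightarrow>\<^sub>0 nat)) \<Rightarrow>\<^sub>0 'k::field_char_0"
  assumes "\<And>q. weyl_act P q = 0"
  shows "P = 0"
proof (rule ccontr)
  assume "P \<noteq> 0"
  then have "\<exists>m. m \<in> Poly_Mapping.keys P"
    by (metis in_keys_iff lookup_zero poly_mapping_eqI)
  then obtain a b where ab: "(a, b) \<in> Poly_Mapping.keys P"
    and least: "\<And>a' b'. (a', b') \<in> Poly_Mapping.keys P \<Longrightarrow>
      (\<Sum>v\<in>UNIV. Poly_Mapping.lookup b v) \<le> (\<Sum>v\<in>UNIV. Poly_Mapping.lookup b' v)"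
    using ex_has_least_nat[of "\<lambda>m. m \<in> Poly_Mapping.keys P" _
        "\<lambda>m. \<Sum>v\<in>UNIV. Poly_Mapping.lookup (snd m) v"]
    by (metis prod.collapse snd_conv)
  have "Poly_Mapping.lookup (weyl_act P (Poly_Mapping.single b 1)) a =
    (\<Sum>m\<in>Poly_Mapping.keys P. Poly_Mapping.lookup (Poly_Mapping.single (fst m + (b - snd m))
      (of_nat (falling b (snd m)) * Poly_Mapping.lookup P m)) a)"
    unfolding weyl_act_def by (simp add: pm_extend_def lookup_sum)
  also have "\<dots> = (\<Sum>m\<in>Poly_Mapping.keys P.
      if m = (a, b) then of_nat (falling b b) * Poly_Mapping.lookup P (a, b) else 0)"
  proof (rule sum.cong[OF refl])
    fix m assume m: "m \<in> Poly_Mapping.keys P"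
    obtain a' b' where [simp]: "m = (a', b')" by (cases m)
    show "Poly_Mapping.lookup (Poly_Mapping.single (fst m + (b - snd m))
        (of_nat (falling b (snd m)) * Poly_Mapping.lookup P m)) a =
      (if m = (a, b) then of_nat (falling b b) * Poly_Mapping.lookup P (a, b) else 0)"
    proof (cases "falling b b' = 0")
      case True
      moreover have "falling b b \<noteq> 0" by (simp only: falling_nonzero_iff) simp
      ultimately show ?thesis by auto
    next
      case False
      then have le: "Poly_Mapping.lookup b' v \<le> Poly_Mapping.lookup b v" for v
        unfolding falling_nonzero_iff by blast
      have "b' = b"
      proof (rule poly_mapping_eqI)
        fix v
        show "Poly_Mapping.lookup b' v = Poly_Mapping.lookup b v"
        proof (rule ccontr)
          assume "Poly_Mapping.lookup b' v \<noteq> Poly_Mapping.lookup b v"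
          then have "(\<Sum>v\<in>UNIV. Poly_Mapping.lookup b' v) < (\<Sum>v\<in>UNIV. Poly_Mapping.lookup b v)"
            using le by (intro sum_strict_mono_ex1) (auto simp: le_less)
          then show False using least[of a' b'] m by simp
        qed
      qed
      then show ?thesis by (auto simp: lookup_single when_def)
    qed
  qed
  also have "\<dots> = of_nat (falling b b) * Poly_Mapping.lookup P (a, b)"
    using ab by simp
  finally have "of_nat (falling b b) * Poly_Mapping.lookup P (a, b) = 0"
    using assms by simp
  moreover have "falling b b \<noteq> 0" by (simp only: falling_nonzero_iff) simp
  ultimately show False using ab by (simp add: in_keys_iff)
qed

lemma weyl_times_assoc:
  fixes P Q R :: "(('v::finite \<Rightarrow>\<^sub>0 nat) \<times> ('v \<Rightarrow>\<^sub>0 nat)) \<Rightarrow>\<^sub>0 'k::field_char_0"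
  shows "weyl_times (weyl_times P Q) R = weyl_times P (weyl_times Q R)"
proof -
  have "weyl_times (weyl_times P Q) R - weyl_times P (weyl_times Q R) = 0" (is "?A - ?B = 0")
  proof (rule weyl_act_faithful)
    fix q
    have "weyl_act (?A - ?B) q + weyl_act ?B q = weyl_act ?A q"
      by (simp flip: weyl_act_add_left)
    then show "weyl_act (?A - ?B) q = 0" by (simp add: weyl_act_times)
  qed
  then show ?thesis by simp
qed

lemma weyl_times_one:
  fixes P :: "(('v::finite \<Rightarrow>\<^sub>0 nat) \<times> ('v \<Rightarrow>\<^sub>0 nat)) \<Rightarrow>\<^sub>0 'k::comm_ring_1"
  shows "weyl_times (Poly_Mapping.single (0, 0) 1) P = P"
    and "weyl_times P (Poly_Mapping.single (0, 0) 1) = P"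
proof -
  have 0: "below 0 = {0 :: 'v \<Rightarrow>\<^sub>0 nat}"
    by (auto simp: below_def intro: poly_mapping_eqI)
  have l0: "leibniz b c 0 = 1" for b c :: "'v \<Rightarrow>\<^sub>0 nat" by (simp add: leibniz_def)
  show "weyl_times (Poly_Mapping.single (0, 0) 1) P = P"
    by (induction P rule: pm_induct)
       (simp_all add: weyl_times_add_right weyl_times_single weyl_times_term_def 0 l0)
  have term_one: "weyl_times_term m (0, 0) x = Poly_Mapping.single m x"
    for m :: "('v \<Rightarrow>\<^sub>0 nat) \<times> ('v \<Rightarrow>\<^sub>0 nat)" and x :: 'k
  proof -
    have "weyl_times_term m (0, 0) x = (\<Sum>k\<in>below (snd m). if k = 0 then Poly_Mapping.single m x else 0)"
      unfolding weyl_times_term_def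
    proof (rule sum.cong[OF refl])
      fix k
      show "Poly_Mapping.single (fst m + (fst (0, 0) - k), snd m - k + snd (0, 0))
          (of_nat (leibniz (snd m) (fst (0, 0)) k) * x) =
        (if k = 0 then Poly_Mapping.single m x else 0)"
      proof (cases "k = 0")
        case False
        then have "k \<notin> below 0" by (simp add: 0)
        then show ?thesis using leibniz_zero[of "snd m" 0 k] False by simp
      qed (simp add: l0)
    qed
    also have "\<dots> = Poly_Mapping.single m x"
    proof -
      have "0 \<in> below (snd m)" by (simp add: below_def)
      then show ?thesis by simp
    qed
    finally show ?thesis .
  qed
  show "weyl_times P (Poly_Mapping.single (0, 0) 1) = P"
    by (induction P rule: pm_induct)
       (simp_all add: weyl_times_add_left weyl_times_single term_one)
qed

typedef (overloaded) ('k, 'v) weyl =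
  "UNIV :: ((('v \<Rightarrow>\<^sub>0 nat) \<times> ('v \<Rightarrow>\<^sub>0 nat)) \<Rightarrow>\<^sub>0 'k::zero) set"
  morphisms weyl_coeffs Weyl
  by simp

setup_lifting type_definition_weyl

instantiation weyl :: (field_char_0, finite) ring_1
begin

lift_definition zero_weyl :: "('a, 'b) weyl" is 0 .
lift_definition one_weyl :: "('a, 'b) weyl" is "Poly_Mapping.single (0, 0) 1" .
lift_definition plus_weyl :: "('a, 'b) weyl \<Rightarrow> ('a, 'b) weyl \<Rightarrow> ('a, 'b) weyl" is "(+)" .
lift_definition minus_weyl :: "('a, 'b) weyl \<Rightarrow> ('a, 'b) weyl \<Rightarrow> ('a, 'b) weyl" is "(-)" .
lift_definition uminus_weyl :: "('a, 'b) weyl \<Rightarrow> ('a, 'b) weyl" is uminus .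
lift_definition times_weyl :: "('a, 'b) weyl \<Rightarrow> ('a, 'b) weyl \<Rightarrow> ('a, 'b) weyl" is weyl_times .

instance
proof
  fix P Q R :: "('a, 'b) weyl"
  show "P * Q * R = P * (Q * R)" by transfer (rule weyl_times_assoc)
  show "1 * P = P" "P * 1 = P" by (transfer, simp add: weyl_times_one)+
  show "(P + Q) * R = P * R + Q * R" by transfer (rule weyl_times_add_left)
  show "P * (Q + R) = P * Q + P * R" by transfer (rule weyl_times_add_right)
  show "(0::('a, 'b) weyl) \<noteq> 1"
    by transfer (metis lookup_single_eq lookup_zero zero_neq_one)
qed (transfer, simp add: algebra_simps)+

end

definition weyl_term ::
  "('v \<Rightarrow>\<^sub>0 nat) \<Rightarrow> ('v \<Rightarrow>\<^sub>0 nat) \<Rightarrow> 'k \<Rightarrow> ('k::zero, 'v) weyl"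
  where "weyl_term a b c = Weyl (Poly_Mapping.single (a, b) c)"

definition weyl_var :: "'v \<Rightarrow> ('k::field_char_0, 'v::finite) weyl"
  where "weyl_var v = weyl_term (Poly_Mapping.single v 1) 0 1"

definition weyl_diff :: "'v \<Rightarrow> ('k::field_char_0, 'v::finite) weyl"
  where "weyl_diff v = weyl_term 0 (Poly_Mapping.single v 1) 1"

lemma weyl_term_zero [simp]: "weyl_term a b 0 = (0 :: ('k::field_char_0, 'v::finite) weyl)"
  by (simp add: weyl_term_def zero_weyl_def)

lemma weyl_term_one [simp]: "weyl_term 0 0 1 = (1 :: ('k::field_char_0, 'v::finite) weyl)"
  by (simp add: weyl_term_def one_weyl_def zero_prod_def)

lemma weyl_term_times:
  "weyl_term a b x * weyl_term c d y = (\<Sum>k\<in>below b.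
     weyl_term (a + (c - k)) (b - k + d) (of_nat (leibniz b c k) * (x * y)))"
proof -
  have "Weyl (sum F A) = (\<Sum>k\<in>A. Weyl (F k))" for F and A :: "('b \<Rightarrow>\<^sub>0 nat) set"
    by (induction A rule: infinite_finite_induct)
       (simp_all add: zero_weyl_def plus_weyl.abs_eq[symmetric] eq_onp_same_args)
  then show ?thesis
    by (simp add: weyl_term_def times_weyl_def Weyl_inverse weyl_times_single weyl_times_term_def)
qed

lemma below_0: "below 0 = {0}"
  by (auto simp: below_def intro: poly_mapping_eqI)

lemma leibniz_0: "leibniz b c 0 = 1"
  by (simp add: leibniz_def)

lemma weyl_term_split: "weyl_term a b c = weyl_term a 0 c * weyl_term 0 b 1"
  by (simp add: weyl_term_times below_0 leibniz_0)

lemma below_single_1: "below (Poly_Mapping.single v (Suc 0)) = {0, Poly_Mapping.single v (Suc 0)}"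
proof (intro set_eqI iffI)
  fix k assume k: "k \<in> below (Poly_Mapping.single v (Suc 0))"
  have "k = Poly_Mapping.single v (Poly_Mapping.lookup k v)"
  proof (rule poly_mapping_eqI)
    fix u
    show "Poly_Mapping.lookup k u =
      Poly_Mapping.lookup (Poly_Mapping.single v (Poly_Mapping.lookup k v)) u"
      using k by (cases "u = v") (auto simp: below_def lookup_single when_def dest: spec[of _ u])
  qed
  moreover have "Poly_Mapping.lookup k v \<le> 1"
    using k by (auto simp: below_def lookup_single dest: spec[of _ v])
  ultimately show "k \<in> {0, Poly_Mapping.single v (Suc 0)}"
    by (cases "Poly_Mapping.lookup k v = 0") (auto simp: le_Suc_eq)
qed (auto simp: below_def)

lemma weyl_var_commute: "weyl_var u * weyl_var v = weyl_var v * weyl_var u"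
  by (simp add: weyl_var_def weyl_term_times below_0 leibniz_0 add.commute)

lemma weyl_diff_commute: "weyl_diff u * weyl_diff v = weyl_diff v * weyl_diff u"
proof -
  have "leibniz b 0 k = 0 \<or> k = 0" for b k :: "'b \<Rightarrow>\<^sub>0 nat"
    using leibniz_zero[of b 0 k] by (auto simp: below_0)
  then have "leibniz (Poly_Mapping.single u (Suc 0)) 0 (Poly_Mapping.single u (Suc 0)) = 0" for u :: 'b
    by (metis lookup_single_eq lookup_zero nat.simps(3))
  moreover have "Poly_Mapping.single u (Suc 0) \<noteq> 0" for u :: 'b
    by (metis lookup_single_eq lookup_zero nat.simps(3))
  ultimately show ?thesis
    by (simp add: weyl_diff_def weyl_term_times below_single_1 leibniz_0 add.commute)
qed

lemma weyl_diff_var: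
  "weyl_diff u * weyl_var v = weyl_var v * weyl_diff u + (if u = v then 1 else 0)"
proof -
  have nz: "Poly_Mapping.single u (Suc 0) \<noteq> 0" for u :: 'b
    by (metis lookup_single_eq lookup_zero nat.simps(3))
  have "leibniz (Poly_Mapping.single u (Suc 0)) (Poly_Mapping.single v (Suc 0))
      (Poly_Mapping.single u (Suc 0)) = (if u = v then 1 else 0)"
  proof (cases "u = v")
    case True
    have "fact (if u = v then Suc 0 else 0) = Suc 0" for v by simp
    then show ?thesis using True by (simp add: leibniz_def lookup_single when_def)
  next
    case False
    then have "Poly_Mapping.single u (Suc 0) \<notin> below (Poly_Mapping.single v (Suc 0))"
      using nz by (auto simp: below_def lookup_single when_def intro!: exI[of _ u])
    then show ?thesis using leibniz_zero False by metis
  qed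
  then show ?thesis using nz
    by (simp add: weyl_diff_def weyl_var_def weyl_term_times below_single_1 below_0 leibniz_0)
qed


subsection \<open>Ideals and initial ideals\<close>

definition left_ideal :: "'a::ring_1 set \<Rightarrow> bool"
  where "left_ideal I \<longleftrightarrow> 0 \<in> I \<and> (\<forall>x\<in>I. \<forall>y\<in>I. x + y \<in> I) \<and> (\<forall>r. \<forall>x\<in>I. r * x \<in> I)"

definition prime_ideal :: "'a::comm_ring_1 set \<Rightarrow> bool"
  where "prime_ideal P \<longleftrightarrow> left_ideal P \<and> P \<noteq> UNIV \<and> (\<forall>x y. x * y \<in> P \<longrightarrow> x \<in> P \<or> y \<in> P)"

definition weight :: "('v::finite \<Rightarrow> real) \<Rightarrow> ('v \<Rightarrow>\<^sub>0 nat) \<times> ('v \<Rightarrow>\<^sub>0 nat) \<Rightarrow> real"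
  where "weight w m = (\<Sum>v\<in>UNIV. - w v * real (Poly_Mapping.lookup (fst m) v)
    + w v * real (Poly_Mapping.lookup (snd m) v))"

definition initial_form :: "('v::finite \<Rightarrow> real) \<Rightarrow> ('k::field_char_0, 'v) weyl \<Rightarrow> ('k, 'v) weyl"
  where "initial_form w R =
    (let M = Poly_Mapping.keys (weyl_coeffs R) in
      \<Sum>m | m \<in> M \<and> weight w m = Max (weight w ` M).
        weyl_term (fst m) (snd m) (Poly_Mapping.lookup (weyl_coeffs R) m))"

definition initial_ideal :: "('v::finite \<Rightarrow> real) \<Rightarrow> ('k::field_char_0, 'v) weyl set \<Rightarrow> ('k, 'v) weyl set"
  where "initial_ideal w I = left_ideal hull {initial_form w R | R. R \<in> I \<and> R \<noteq> 0}"


subsection \<open>The ideal \<open>I\<^sub>f\<close> in \<open>D\<^sub>Y\<close>\<close>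

text \<open>
  The variables of \<open>D\<^sub>Y\<close> are indexed by \<open>'n option\<close>: \<open>Some i\<close> stands for
  \<open>x\<^sub>i\<close> and \<open>None\<close> for \<open>t\<close>.
\<close>

definition poly_to_DY :: "('k::field_char_0, 'n::finite) mpoly \<Rightarrow> ('k, 'n option) weyl"
  where "poly_to_DY p = (\<Sum>\<alpha>\<in>Poly_Mapping.keys p.
    weyl_term (\<Sum>i\<in>UNIV. Poly_Mapping.single (Some i) (Poly_Mapping.lookup \<alpha> i)) 0
      (Poly_Mapping.lookup p \<alpha>))"

definition I_f :: "('k::field_char_0, 'n::finite) mpoly \<Rightarrow> ('k, 'n option) weyl set"
  where "I_f f = left_ideal hull
    ({weyl_var None - poly_to_DY f} \<union>
     {weyl_diff (Some i) + poly_to_DY (pdiff i f) * weyl_diff None | i. True})"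

definition w_t :: "'n option \<Rightarrow> real"
  where "w_t v = (case v of None \<Rightarrow> 1 | Some i \<Rightarrow> 0)"

text \<open>\<open>K[x,s]\<close> is represented as \<open>K[x][s]\<close>.\<close>

definition s_in_DY :: "('k::field_char_0, 'n::finite option) weyl"
  where "s_in_DY = - (weyl_diff None * weyl_var None)"

definition Kxs_to_DY :: "('k::field_char_0, 'n::{finite,linorder}) mpoly poly \<Rightarrow> ('k, 'n option) weyl"
  where "Kxs_to_DY p = (\<Sum>i\<le>degree p. poly_to_DY (coeff p i) * s_in_DY ^ i)"


subsection \<open>Groebner bases in \<open>K[x,s]\<close>\<close>

text \<open>
  The pair \<open>(\<alpha>, i)\<close> stands for the monomial \<open>x\<^sup>\<alpha> s\<^sup>i\<close>;
  \<open>(u, v) \<in> r\<close> means that \<open>u\<close> is less than or equal to \<open>v\<close>.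
\<close>

type_synonym 'n xs_monom = "('n \<Rightarrow>\<^sub>0 nat) \<times> nat"

definition monomial_order :: "'n xs_monom rel \<Rightarrow> bool"
  where "monomial_order r \<longleftrightarrow> well_order_on UNIV r \<and>
    (\<forall>u v w. (u, v) \<in> r \<longrightarrow> (u + w, v + w) \<in> r)"

definition eliminates_s :: "'n xs_monom rel \<Rightarrow> bool"
  where "eliminates_s r \<longleftrightarrow> (\<forall>\<alpha> \<beta> i. 0 < i \<longrightarrow> ((\<alpha>, 0), (\<beta>, i)) \<in> r)"

definition xs_monoms :: "('k::comm_ring_1, 'n) mpoly poly \<Rightarrow> 'n xs_monom set"
  where "xs_monoms p = {(\<alpha>, i). Poly_Mapping.lookup (coeff p i) \<alpha> \<noteq> 0}"

definition leading_monom :: "'n xs_monom rel \<Rightarrow> ('k::comm_ring_1, 'n) mpoly poly \<Rightarrow> 'n xs_monom"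
  where "leading_monom r p = (THE m. m \<in> xs_monoms p \<and> (\<forall>m'\<in>xs_monoms p. (m', m) \<in> r))"

definition leading_term ::
  "'n xs_monom rel \<Rightarrow> ('k::comm_ring_1, 'n) mpoly poly \<Rightarrow> ('k, 'n) mpoly poly"
  where "leading_term r p = (if p = 0 then 0 else
    (let (\<alpha>, i) = leading_monom r p in
      monom (Poly_Mapping.single \<alpha> (Poly_Mapping.lookup (coeff p i) \<alpha>)) i))"

definition groebner_basis ::
  "'n xs_monom rel \<Rightarrow> ('k::comm_ring_1, 'n) mpoly poly set \<Rightarrow> ('k, 'n) mpoly poly set \<Rightarrow> bool"
  where "groebner_basis r G I \<longleftrightarrow> finite G \<and> G \<subseteq> I \<and>
    left_ideal hull (leading_term r ` G) = left_ideal hull (leading_term r ` I)"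


subsection \<open>The module \<open>K[x][f\<^sup>-\<^sup>1,s] f\<^sup>s\<close>\<close>

text \<open>
  The element \<open>g f\<^sup>s\<close> of \<open>K[x]\<^sub>P \<otimes> K[x][f\<^sup>-\<^sup>1,s] f\<^sup>s\<close> is represented by the
  polynomial \<open>g\<close> in \<open>s\<close>; all its coefficients are taken in the field \<open>K(x)\<close>, which
  contains \<open>K[x][f\<^sup>-\<^sup>1]\<close> and \<open>K[x]\<^sub>P\<close>.
\<close>

type_synonym ('k, 'n) ratfun = "('k, 'n) mpoly fract"

lift_definition fdiff ::
  "'n \<Rightarrow> ('k::field_char_0, 'n::linorder) ratfun \<Rightarrow> ('k, 'n) ratfun"
  is "\<lambda>i (p, q). (pdiff i p * q - p * pdiff i q, q * q)"
proof (clarsimp simp: fractrel_def)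
  fix i :: 'n and p q p' q' :: "('k, 'n) mpoly"
  assume "q \<noteq> 0" "q' \<noteq> 0" and eq: "p * q' = p' * q"
  have d: "pdiff i p * q' + p * pdiff i q' = pdiff i p' * q + p' * pdiff i q"
    using arg_cong[OF eq, of "pdiff i"] by (simp only: pdiff_mult)
  have "(pdiff i p * q - p * pdiff i q) * (q' * q') - (pdiff i p' * q' - p' * pdiff i q') * (q * q) =
     q * q' * ((pdiff i p * q' + p * pdiff i q') - (pdiff i p' * q + p' * pdiff i q))
     - (p * q' - p' * q) * (q * pdiff i q' + q' * pdiff i q)"
    by (simp add: algebra_simps)
  then show "(pdiff i p * q - p * pdiff i q) * (q' * q') = (pdiff i p' * q' - p' * pdiff i q') * (q * q)"
    by (simp add: d eq)
qed

definition fs_diff ::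
  "('k::field_char_0, 'n::linorder) mpoly \<Rightarrow> 'n \<Rightarrow> ('k, 'n) ratfun poly \<Rightarrow> ('k, 'n) ratfun poly"
  where "fs_diff f i g = map_poly (fdiff i) g + [:0, 1:] * [:Fract (pdiff i f) f:] * g"

text \<open>The operators \<open>\<partial>\<^sub>i\<close> commute, so the order of composition is immaterial.\<close>

definition fs_diff_pow ::
  "('k::field_char_0, 'n::{finite,linorder}) mpoly \<Rightarrow> ('n \<Rightarrow>\<^sub>0 nat)
    \<Rightarrow> ('k, 'n) ratfun poly \<Rightarrow> ('k, 'n) ratfun poly"
  where "fs_diff_pow f b =
    fold (\<lambda>i. fs_diff f i ^^ Poly_Mapping.lookup b i) (sorted_list_of_set UNIV)"

definition localization :: "'a::idom set \<Rightarrow> 'a fract set"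
  where "localization P = {Fract a c | a c. c \<notin> P}"

text \<open>
  \<open>D\<^sub>X[s]\<close> is a free left \<open>K[x]\<close>-module on the \<open>\<partial>\<^sup>b s\<^sup>j\<close>, so an element of
  \<open>K[x]\<^sub>P \<otimes> D\<^sub>X[s]\<close> is a finite sum of terms \<open>q\<^sub>b \<partial>\<^sup>b\<close> with
  \<open>q\<^sub>b\<close> in \<open>K[x]\<^sub>P[s]\<close>.
\<close>

definition local_operators ::
  "('k::field_char_0, 'n::linorder) mpoly set \<Rightarrow> (('n \<Rightarrow>\<^sub>0 nat) \<Rightarrow>\<^sub>0 ('k, 'n) ratfun poly) set"
  where "local_operators P =
    {Q. \<forall>b j. coeff (Poly_Mapping.lookup Q b) j \<in> localization P}"

definition fs_act ::
  "('k::field_char_0, 'n::{finite,linorder}) mpoly \<Rightarrow> (('n \<Rightarrow>\<^sub>0 nat) \<Rightarrow>\<^sub>0 ('k, 'n) ratfun poly)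
    \<Rightarrow> ('k, 'n) ratfun poly \<Rightarrow> ('k, 'n) ratfun poly"
  where "fs_act f Q g =
    (\<Sum>b\<in>Poly_Mapping.keys Q. Poly_Mapping.lookup Q b * fs_diff_pow f b g)"

definition const_ratfun :: "'k \<Rightarrow> ('k::field_char_0, 'n::linorder) ratfun"
  where "const_ratfun c = Fract (Poly_Mapping.single 0 c) 1"

text \<open>Here \<open>f\<^sup>s\<^sup>+\<^sup>1 = f \<cdot> f\<^sup>s\<close> is represented by the constant polynomial \<open>f\<close>.\<close>

definition local_functional_equation ::
  "('k::field_char_0, 'n::{finite,linorder}) mpoly \<Rightarrow> ('k, 'n) mpoly set \<Rightarrow> 'k poly \<Rightarrow> bool"
  where "local_functional_equation f P b \<longleftrightarrow>
    (\<exists>Q\<in>local_operators P. fs_act f Q [:Fract f 1:] = map_poly const_ratfun b)"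

definition is_local_bs_poly ::
  "('k::field_char_0, 'n::{finite,linorder}) mpoly \<Rightarrow> ('k, 'n) mpoly set \<Rightarrow> 'k poly \<Rightarrow> bool"
  where "is_local_bs_poly f P b \<longleftrightarrow> lead_coeff b = 1 \<and> local_functional_equation f P b \<and>
    (\<forall>c. lead_coeff c = 1 \<and> local_functional_equation f P c \<longrightarrow> degree b \<le> degree c)"

text \<open>
  For \<open>f \<noteq> 0\<close> the polynomial exists by Bernstein's theorem; otherwise the
  convention is \<open>0\<close>, the generator of the zero ideal.
\<close>

definition local_bs_poly ::
  "('k::field_char_0, 'n::{finite,linorder}) mpoly \<Rightarrow> ('k, 'n) mpoly set \<Rightarrow> 'k poly"
  where "local_bs_poly f P =
    (if \<exists>b. is_local_bs_poly f P b then THE b. is_local_bs_poly f P b else 0)"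

end

theory Submission
  imports Defs "HOL-Computational_Algebra.Polynomial_Factorial"
begin

text \<open>
  Everything is translated into the module \<open>D\<^sub>X[s] f\<^sup>s\<^sup>+\<^sup>1\<close> inside \<open>K(x)[s] f\<^sup>s\<close>.

  The algebra \<open>D\<^sub>Y\<close> acts on \<open>K(x)[s] f\<^sup>s\<close>, where \<open>t\<close> is the shift \<open>s \<mapsto> s + 1\<close> and
  \<open>- \<partial>\<^sub>t t\<close> is multiplication by \<open>s\<close>.  The ideal \<open>I\<^sub>f\<close> is exactly the annihilator of \<open>f\<^sup>s\<close>
  (\<open>I_f_eq_annihilator\<close>).  Its generators annihilate \<open>f\<^sup>s\<close>; conversely every operator is congruent
  modulo \<open>I\<^sub>f\<close> to a sum of terms \<open>p(x) \<partial>\<^sub>t\<^sup>k\<close>, and such a sum can annihilate \<open>f\<^sup>s\<close> only if it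
  is zero, since \<open>\<partial>\<^sub>t\<^sup>k f\<^sup>s\<close> has degree exactly \<open>k\<close> in \<open>s\<close>.

  An element \<open>p\<close> of \<open>K[x,s]\<close> has weight \<open>0\<close> in \<open>D\<^sub>Y\<close>, so it lies in the initial ideal
  iff \<open>p + R\<close> annihilates \<open>f\<^sup>s\<close> for some \<open>R\<close> of negative weight.  Operators of negative weight carry
  at least one excess factor \<open>t\<close>, and \<open>t f\<^sup>s = f\<^sup>s\<^sup>+\<^sup>1\<close>.  Hence \<open>p\<close> lies in the initial ideal iff
  \<open>p f\<^sup>s\<close> lies in \<open>D\<^sub>X[s] f\<^sup>s\<^sup>+\<^sup>1\<close> (\<open>in_initial_ideal_iff\<close>).

  A local functional equation at \<open>P\<close> for \<open>b(s)\<close> becomes, after clearing denominators, a functional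
  equation over \<open>D\<^sub>X[s]\<close> for \<open>c b(s)\<close> with some \<open>c\<close> outside \<open>P\<close>.  Therefore \<open>b\<^sub>f\<^sub>,\<^sub>P\<close> divides \<open>b\<close>
  iff \<open>c b(s)\<close> is in the initial ideal for some such \<open>c\<close>
  (\<open>local_bs_poly_dvd_iff\<close>, \<open>local_functional_equation_iff_in_initial_ideal\<close>).

  Finally, \<open>c b(s)\<close> has degree at most \<open>d\<close> in \<open>s\<close>, and for an elimination order the elements of
  \<open>s\<close>-degree at most \<open>d\<close> in the ideal are the \<open>K[x]\<close>-linear combinations of \<open>G\<^sub>2\<close>.  So the \<open>c\<close> with
  \<open>c b(s)\<close> in the ideal are precisely the last entries of the syzygies (\<open>groebner_basis_syzygy\<close>).
\<close>

section \<open>Representations of the Weyl algebra\<close>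

lemma exponent_induct [case_names zero add_single]:
  fixes a :: "'v::finite \<Rightarrow>\<^sub>0 nat"
  assumes "P 0" and "\<And>a v. P a \<Longrightarrow> P (a + Poly_Mapping.single v 1)"
  shows "P a"
proof (induction "\<Sum>v\<in>UNIV. Poly_Mapping.lookup a v" arbitrary: a rule: less_induct)
  case less
  show ?case
  proof (cases "a = 0")
    case False
    then obtain v where v: "Poly_Mapping.lookup a v \<noteq> 0"
      by (metis lookup_zero poly_mapping_eqI)
    define a' where "a' = a - Poly_Mapping.single v 1"
    have a: "a = a' + Poly_Mapping.single v 1"
      unfolding a'_def using v
      by (intro poly_mapping_eqI) (auto simp: lookup_add lookup_minus lookup_single when_def)
    have "(\<Sum>v\<in>UNIV. Poly_Mapping.lookup a' v) < (\<Sum>v\<in>UNIV. Poly_Mapping.lookup a v)"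
      by (rule sum_strict_mono_ex1)
         (auto simp: a lookup_add lookup_single when_def intro!: exI[of _ v])
    then show ?thesis using less assms(2) a by metis
  qed (use assms in simp)
qed

text \<open>
  The order of composition follows that of \<^const>\<open>fs_diff_pow\<close>, so that both are powers of the
  same kind.  For commuting operators it is immaterial.
\<close>

definition op_pow :: "('v::{finite,linorder} \<Rightarrow> 'm \<Rightarrow> 'm) \<Rightarrow> ('v \<Rightarrow>\<^sub>0 nat) \<Rightarrow> 'm \<Rightarrow> 'm"
  where "op_pow F a = fold (\<lambda>v. F v ^^ Poly_Mapping.lookup a v) (sorted_list_of_set UNIV)"

lemma fs_diff_pow_eq_op_pow: "fs_diff_pow f b = op_pow (fs_diff f) b"
  by (simp add: fs_diff_pow_def op_pow_def)

lemma op_pow_0 [simp]: "op_pow F 0 g = g"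
proof -
  have "fold (\<lambda>v. F v ^^ Poly_Mapping.lookup 0 v) xs g = g" for xs
    by (induction xs) simp_all
  then show ?thesis by (simp add: op_pow_def)
qed

lemma op_pow_add_single:
  assumes comm: "\<And>u v g. F u (F v g) = F v (F u g)"
  shows "op_pow F (a + Poly_Mapping.single v 1) g = F v (op_pow F a g)"
proof -
  define a' where "a' = a + Poly_Mapping.single v 1"
  have lookup_a': "Poly_Mapping.lookup a' u = (if u = v then Suc (Poly_Mapping.lookup a v) else Poly_Mapping.lookup a u)"
    for u by (simp add: a'_def lookup_add lookup_single)
  have pow: "F u ((F w ^^ n) g) = (F w ^^ n) (F u g)" for u w n g
    by (induction n) (simp_all add: comm[of u w])
  have pass: "F u (fold (\<lambda>v. F v ^^ Poly_Mapping.lookup a v) xs g) =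
      fold (\<lambda>v. F v ^^ Poly_Mapping.lookup a v) xs (F u g)" for u xs g
    by (induction xs arbitrary: g) (simp_all add: pow)
  have same: "fold (\<lambda>v. F v ^^ Poly_Mapping.lookup a' v) xs h =
      fold (\<lambda>v. F v ^^ Poly_Mapping.lookup a v) xs h" if "v \<notin> set xs" for xs h
    using that by (induction xs arbitrary: h) (auto simp: lookup_a')
  have "fold (\<lambda>v. F v ^^ Poly_Mapping.lookup a' v) xs g =
      F v (fold (\<lambda>v. F v ^^ Poly_Mapping.lookup a v) xs g)" if "distinct xs" "v \<in> set xs" for xs g
    using that
  proof (induction xs arbitrary: g)
    case (Cons y ys)
    show ?case
    proof (cases "y = v")
      case True
      then have "fold (\<lambda>v. F v ^^ Poly_Mapping.lookup a' v) (y # ys) g =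
          fold (\<lambda>v. F v ^^ Poly_Mapping.lookup a' v) ys (F v ((F v ^^ Poly_Mapping.lookup a v) g))"
        by (simp add: lookup_a')
      also have "\<dots> = F v (fold (\<lambda>v. F v ^^ Poly_Mapping.lookup a v) (y # ys) g)"
        using Cons.prems True by (simp add: same pass)
      finally show ?thesis .
    next
      case False
      then show ?thesis using Cons by (simp add: lookup_a')
    qed
  qed simp
  then show ?thesis by (simp add: op_pow_def a'_def)
qed

abbreviation weyl_coeff :: "('k::zero, 'v) weyl \<Rightarrow> ('v \<Rightarrow>\<^sub>0 nat) \<times> ('v \<Rightarrow>\<^sub>0 nat) \<Rightarrow> 'k"
  where "weyl_coeff R \<equiv> Poly_Mapping.lookup (weyl_coeffs R)"

lemma weyl_coeff_add: "weyl_coeff (R + S) m = weyl_coeff R m + weyl_coeff S m"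
  by (simp add: plus_weyl.rep_eq lookup_add)

lemma weyl_coeff_diff: "weyl_coeff (R - S) m = weyl_coeff R m - weyl_coeff S m"
  by (simp add: minus_weyl.rep_eq lookup_minus)

lemma weyl_coeff_0 [simp]: "weyl_coeff 0 m = 0"
  by (simp add: zero_weyl.rep_eq)

lemma weyl_eqI: "(\<And>m. weyl_coeff R m = weyl_coeff S m) \<Longrightarrow> R = S"
  by (metis poly_mapping_eqI weyl_coeffs_inject)

lemma weyl_coeff_sum: "weyl_coeff (sum F A) m = (\<Sum>a\<in>A. weyl_coeff (F a) m)"
  by (induction A rule: infinite_finite_induct) (simp_all add: weyl_coeff_add)

lemma weyl_coeffs_term: "weyl_coeffs (weyl_term a b c) = Poly_Mapping.single (a, b) c"
  by (simp add: weyl_term_def Weyl_inverse)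

lemma weyl_coeff_term: "weyl_coeff (weyl_term a b c) m = (if m = (a, b) then c else 0)"
  by (auto simp: weyl_coeffs_term lookup_single when_def)

lemma weyl_term_add: "weyl_term a b (c + d) = weyl_term a b c + weyl_term a b d"
  by (rule weyl_eqI) (auto simp: weyl_coeff_term weyl_coeff_add)

lemma weyl_term_induct [case_names monom add]:
  fixes R :: "('k::field_char_0, 'v::finite) weyl"
  assumes monom: "\<And>a b c. P (weyl_term a b c)" and add: "\<And>R S. P R \<Longrightarrow> P S \<Longrightarrow> P (R + S)"
  shows "P R"
proof -
  have "P (Weyl p)" for p
  proof (induction p rule: pm_induct)
    case (single m c)
    then show ?case using monom[of "fst m" "snd m" c] by (simp add: weyl_term_def)
  next
    case (add p q)
    then show ?case using assms(2)[of "Weyl p" "Weyl q"]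
      by (simp add: plus_weyl.abs_eq eq_onp_same_args)
  qed
  then show ?thesis by (metis weyl_coeffs_inverse)
qed

lemma weyl_scalar_times_term: "weyl_term 0 0 x * weyl_term a b c = weyl_term a b (x * c)"
  by (simp add: weyl_term_times below_0 leibniz_0)

lemma weyl_var_times_term:
  "weyl_var v * weyl_term a b c = weyl_term (a + Poly_Mapping.single v 1) b c"
  by (simp add: weyl_var_def weyl_term_times below_0 leibniz_0 add.commute)

lemma leibniz_single:
  "leibniz (Poly_Mapping.single v (Suc 0)) a (Poly_Mapping.single v (Suc 0)) = Poly_Mapping.lookup a v"
proof -
  have "leibniz (Poly_Mapping.single v (Suc 0)) a (Poly_Mapping.single v (Suc 0)) =
      (\<Prod>u\<in>UNIV. if u = v then Poly_Mapping.lookup a v else 1)"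
    unfolding leibniz_def by (rule prod.cong) (auto simp: lookup_single when_def)
  then show ?thesis by simp
qed

lemma single_Suc_0_neq_0 [simp]: "Poly_Mapping.single v (Suc 0) \<noteq> 0"
  by (metis lookup_single_eq lookup_zero nat.simps(3))

lemma weyl_diff_times_term:
  "weyl_diff v * weyl_term a b c = weyl_term a (b + Poly_Mapping.single v 1) c
     + weyl_term (a - Poly_Mapping.single v 1) b (of_nat (Poly_Mapping.lookup a v) * c)"
  by (simp add: weyl_diff_def weyl_term_times below_single_1 leibniz_0 leibniz_single
      single_Suc_0_neq_0[symmetric] add.commute)

text \<open>
  Induction along left multiplication by generators reduces multiplicativity of an action to the
  commutation relations of single variables, in place of the multi-index Leibniz rule.
\<close>

lemma weyl_induct [case_names scalar var diff add]:
  fixes R :: "('k::field_char_0, 'v::finite) weyl"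
  assumes scalar: "\<And>c. P (weyl_term 0 0 c)"
    and var: "\<And>R v. P R \<Longrightarrow> P (weyl_var v * R)" and diff: "\<And>R v. P R \<Longrightarrow> P (weyl_diff v * R)"
    and add: "\<And>R S. P R \<Longrightarrow> P S \<Longrightarrow> P (R + S)"
  shows "P R"
proof (induction R rule: weyl_term_induct)
  case (monom a b c)
  have "P (weyl_term 0 b c)"
  proof (induction b rule: exponent_induct)
    case (add_single b v)
    then show ?case using diff[of "weyl_term 0 b c" v] by (simp add: weyl_diff_times_term)
  qed (rule scalar)
  then show ?case
  proof (induction a rule: exponent_induct)
    case (add_single a v)
    then show ?case using var[of "weyl_term a b c" v] by (simp add: weyl_var_times_term)
  qed
qed (rule add)

text \<open>
  This is the universal property of the Weyl algebra: operators that satisfy the canonical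
  commutation relations extend to an action of the whole algebra, defined on normally ordered terms.
\<close>

locale weyl_rep = module scale
  for scale :: "'k::field_char_0 \<Rightarrow> 'm::ab_group_add \<Rightarrow> 'm" +
  fixes X D :: "'v::{finite,linorder} \<Rightarrow> 'm \<Rightarrow> 'm"
  assumes X_add: "X v (g + h) = X v g + X v h" and X_scale: "X v (scale c g) = scale c (X v g)"
    and D_add: "D v (g + h) = D v g + D v h" and D_scale: "D v (scale c g) = scale c (D v g)"
    and X_commute: "X u (X v g) = X v (X u g)" and D_commute: "D u (D v g) = D v (D u g)"
    and D_X: "D u (X v g) = X v (D u g) + (if u = v then g else 0)"
begin

definition act :: "('k, 'v) weyl \<Rightarrow> 'm \<Rightarrow> 'm"
  where "act R g = pm_extend (\<lambda>m c. scale c (op_pow X (fst m) (op_pow D (snd m) g))) (weyl_coeffs R)"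

lemma X_pow: "op_pow X (a + Poly_Mapping.single v 1) g = X v (op_pow X a g)"
  by (rule op_pow_add_single) (rule X_commute)

lemma D_pow: "op_pow D (a + Poly_Mapping.single v 1) g = D v (op_pow D a g)"
  by (rule op_pow_add_single) (rule D_commute)

lemma act_term: "act (weyl_term a b c) g = scale c (op_pow X a (op_pow D b g))"
  by (simp add: act_def weyl_coeffs_term pm_extend_single)

lemma act_add_left: "act (R + S) g = act R g + act S g"
  by (simp add: act_def plus_weyl.rep_eq pm_extend_add scale_left_distrib)

lemma act_zero_left [simp]: "act 0 g = 0"
  by (simp add: act_def zero_weyl.rep_eq)

lemma act_one [simp]: "act 1 g = g"
  by (simp add: act_term flip: weyl_term_one)

lemma act_diff_left: "act (R - S) g = act R g - act S g"
  using act_add_left[of "R - S" S g] by (simp add: algebra_simps)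

lemma act_uminus_left: "act (- R) g = - act R g"
  using act_diff_left[of 0 R g] by simp

lemma act_sum_left: "act (sum F A) g = (\<Sum>a\<in>A. act (F a) g)"
  by (induction A rule: infinite_finite_induct) (simp_all add: act_add_left)

lemma X_pow_add: "op_pow X a (g + h) = op_pow X a g + op_pow X a h"
  by (induction a rule: exponent_induct) (simp_all only: op_pow_0 X_pow X_add)

lemma D_pow_add: "op_pow D a (g + h) = op_pow D a g + op_pow D a h"
  by (induction a rule: exponent_induct) (simp_all only: op_pow_0 D_pow D_add)

lemma act_add_right: "act R (g + h) = act R g + act R h"
  by (simp add: act_def X_pow_add D_pow_add scale_right_distrib pm_extend_add_fun)

lemma D_X_pow: "D v (op_pow X a g) =
  op_pow X a (D v g) + scale (of_nat (Poly_Mapping.lookup a v)) (op_pow X (a - Poly_Mapping.single v 1) g)"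
proof (induction a rule: exponent_induct)
  case (add_single a u)
  let ?e = "\<lambda>v. Poly_Mapping.single v (1::nat)"
  have "scale (of_nat (Poly_Mapping.lookup a v)) (X u (op_pow X (a - ?e v) g)) =
      scale (of_nat (Poly_Mapping.lookup a v)) (op_pow X (a + ?e u - ?e v) g)"
  proof (cases "Poly_Mapping.lookup a v = 0")
    case False
    then have "a + ?e u - ?e v = a - ?e v + ?e u"
      by (intro poly_mapping_eqI) (auto simp: lookup_add lookup_minus lookup_single when_def)
    then show ?thesis by (simp only: X_pow)
  qed simp
  then have "D v (op_pow X (a + ?e u) g) = op_pow X (a + ?e u) (D v g)
      + scale (of_nat (Poly_Mapping.lookup a v)) (op_pow X (a + ?e u - ?e v) g)
      + (if v = u then op_pow X a g else 0)"
    by (simp only: X_pow D_X add_single.IH X_add X_scale)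
  also have "\<dots> = op_pow X (a + ?e u) (D v g)
      + scale (of_nat (Poly_Mapping.lookup (a + ?e u) v)) (op_pow X (a + ?e u - ?e v) g)"
    by (auto simp: lookup_add lookup_single when_def scale_left_distrib add.assoc add_ac)
  finally show ?case .
qed simp

lemma act_scalar: "act (weyl_term 0 0 c) g = scale c g"
  by (simp add: act_term)

lemma act_scalar_times: "act (weyl_term 0 0 c * R) g = scale c (act R g)"
  by (induction R rule: weyl_term_induct)
     (simp_all add: weyl_scalar_times_term act_term distrib_left act_add_left scale_right_distrib)

lemma act_var_times: "act (weyl_var v * R) g = X v (act R g)"
proof (induction R rule: weyl_term_induct)
  case (monom a b c)
  then show ?case by (simp only: weyl_var_times_term act_term X_pow X_scale)
qed (simp add: distrib_left act_add_left X_add)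

lemma act_diff_times: "act (weyl_diff v * R) g = D v (act R g)"
proof (induction R rule: weyl_term_induct)
  case (monom a b c)
  have "act (weyl_diff v * weyl_term a b c) g = scale c (op_pow X a (D v (op_pow D b g)))
    + scale c (scale (of_nat (Poly_Mapping.lookup a v)) (op_pow X (a - Poly_Mapping.single v 1) (op_pow D b g)))"
    by (simp only: weyl_diff_times_term act_add_left act_term D_pow scale_scale mult.commute)
  also have "\<dots> = D v (act (weyl_term a b c) g)"
    by (simp only: act_term D_scale D_X_pow scale_right_distrib)
  finally show ?case .
qed (simp add: distrib_left act_add_left D_add)

lemma act_times: "act (R * S) g = act R (act S g)"
proof (induction R rule: weyl_induct)
  case (add R T)
  then show ?case by (simp add: distrib_right act_add_left)
qed (simp_all add: act_scalar_times act_scalar act_var_times act_diff_times mult.assoc)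

lemma act_var: "act (weyl_var v) g = X v g"
  using act_var_times[of v 1 g] by simp

lemma act_diff: "act (weyl_diff v) g = D v g"
  using act_diff_times[of v 1 g] by simp

lemma left_ideal_annihilator: "left_ideal {R. act R g = 0}"
proof -
  have "act R 0 = 0" for R using act_add_right[of R 0 0] by simp
  then show ?thesis by (simp add: left_ideal_def act_add_left act_times)
qed

end

section \<open>The grading by weight and the initial ideal\<close>

lemma left_ideal_hull: "left_ideal (left_ideal hull S)"
  by (rule hull_in) (auto simp: left_ideal_def)

lemma left_ideal_0: "left_ideal I \<Longrightarrow> 0 \<in> I"
  and left_ideal_add: "left_ideal I \<Longrightarrow> x \<in> I \<Longrightarrow> y \<in> I \<Longrightarrow> x + y \<in> I"
  and left_ideal_times: "left_ideal I \<Longrightarrow> x \<in> I \<Longrightarrow> r * x \<in> I"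
  by (simp_all add: left_ideal_def)

lemma left_ideal_uminus: "left_ideal I \<Longrightarrow> x \<in> I \<Longrightarrow> - x \<in> I"
  using left_ideal_times[of I x "- 1"] by simp

lemma left_ideal_diff: "left_ideal I \<Longrightarrow> x \<in> I \<Longrightarrow> y \<in> I \<Longrightarrow> x - y \<in> I"
  using left_ideal_add[of I x "- y"] left_ideal_uminus by force

lemma left_ideal_sum: "left_ideal I \<Longrightarrow> (\<And>a. a \<in> A \<Longrightarrow> F a \<in> I) \<Longrightarrow> sum F A \<in> I"
  by (induction A rule: infinite_finite_induct) (auto intro: left_ideal_0 left_ideal_add)

definition homogeneous :: "('v::finite \<Rightarrow> real) \<Rightarrow> real \<Rightarrow> ('k::field_char_0, 'v) weyl set"
  where "homogeneous w e = {R. \<forall>m. weyl_coeff R m \<noteq> 0 \<longrightarrow> weight w m = e}"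

definition weight_le :: "('v::finite \<Rightarrow> real) \<Rightarrow> real \<Rightarrow> ('k::field_char_0, 'v) weyl set"
  where "weight_le w e = {R. \<forall>m. weyl_coeff R m \<noteq> 0 \<longrightarrow> weight w m \<le> e}"

definition component :: "('v::finite \<Rightarrow> real) \<Rightarrow> real \<Rightarrow> ('k::field_char_0, 'v) weyl \<Rightarrow> ('k, 'v) weyl"
  where "component w e R =
    (\<Sum>m | m \<in> Poly_Mapping.keys (weyl_coeffs R) \<and> weight w m = e. weyl_term (fst m) (snd m) (weyl_coeff R m))"

lemma weyl_coeff_component: "weyl_coeff (component w e R) m = (if weight w m = e then weyl_coeff R m else 0)"
proof -
  let ?M = "{m \<in> Poly_Mapping.keys (weyl_coeffs R). weight w m = e}"
  have "weyl_coeff (component w e R) m = (\<Sum>m'\<in>?M. if m' = m then weyl_coeff R m else 0)"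
    unfolding component_def weyl_coeff_sum by (rule sum.cong) (auto simp: weyl_coeff_term)
  then show ?thesis by (auto simp: in_keys_iff)
qed

lemma initial_form_eq_component:
  "initial_form w R = component w (Max (weight w ` Poly_Mapping.keys (weyl_coeffs R))) R"
  by (simp add: initial_form_def component_def Let_def)

lemma component_add: "component w e (R + S) = component w e R + component w e S"
  by (rule weyl_eqI) (simp add: weyl_coeff_component weyl_coeff_add)

lemma component_0 [simp]: "component w e 0 = 0"
  by (rule weyl_eqI) (simp add: weyl_coeff_component)

lemma component_homogeneous: "R \<in> homogeneous w e \<Longrightarrow> component w e' R = (if e' = e then R else 0)"
  by (rule weyl_eqI) (auto simp: weyl_coeff_component homogeneous_def)

lemma component_in_homogeneous: "component w e R \<in> homogeneous w e"
  by (simp add: homogeneous_def weyl_coeff_component)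

lemma homogeneous_0 [simp]: "0 \<in> homogeneous w e"
  by (simp add: homogeneous_def)

lemma homogeneous_add: "R \<in> homogeneous w e \<Longrightarrow> S \<in> homogeneous w e \<Longrightarrow> R + S \<in> homogeneous w e"
proof -
  have "weyl_coeff R m \<noteq> 0 \<or> weyl_coeff S m \<noteq> 0" if "weyl_coeff (R + S) m \<noteq> 0" for m
    using that by (auto simp: weyl_coeff_add)
  moreover assume "R \<in> homogeneous w e" "S \<in> homogeneous w e"
  ultimately show ?thesis unfolding homogeneous_def by blast
qed

lemma homogeneous_sum: "(\<And>a. a \<in> A \<Longrightarrow> F a \<in> homogeneous w e) \<Longrightarrow> sum F A \<in> homogeneous w e"
  by (induction A rule: infinite_finite_induct) (auto intro: homogeneous_add)

lemma homogeneous_uminus: "R \<in> homogeneous w e \<Longrightarrow> - R \<in> homogeneous w e"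
  using weyl_coeff_diff[of 0 R] by (simp add: homogeneous_def)

lemma homogeneous_term: "weyl_term a b c \<in> homogeneous w (weight w (a, b))"
  by (simp add: homogeneous_def weyl_coeff_term)

text \<open>The Leibniz rule trades \<open>x\<^sub>v\<close> and \<open>\<partial>\<^sub>v\<close> in pairs, whose weights cancel.\<close>

lemma homogeneous_term_times_term:
  "weyl_term a b x * weyl_term c d y \<in> homogeneous w (weight w (a, b) + weight w (c, d))"
  unfolding weyl_term_times
proof (rule homogeneous_sum)
  fix k assume k: "k \<in> below b"
  show "weyl_term (a + (c - k)) (b - k + d) (of_nat (leibniz b c k) * (x * y))
      \<in> homogeneous w (weight w (a, b) + weight w (c, d))"
  proof (cases "leibniz b c k = 0")
    case False
    then have "k \<in> below c" using leibniz_zero[of b c k] by simp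
    have "weight w (a + (c - k), b - k + d) = weight w (a, b) + weight w (c, d)"
      unfolding weight_def sum.distrib[symmetric]
    proof (rule sum.cong)
      fix v
      show "- w v * real (Poly_Mapping.lookup (fst (a + (c - k), b - k + d)) v) +
          w v * real (Poly_Mapping.lookup (snd (a + (c - k), b - k + d)) v) =
         - w v * real (Poly_Mapping.lookup (fst (a, b)) v) + w v * real (Poly_Mapping.lookup (snd (a, b)) v) +
         (- w v * real (Poly_Mapping.lookup (fst (c, d)) v) + w v * real (Poly_Mapping.lookup (snd (c, d)) v))"
      proof -
        have "real (Poly_Mapping.lookup b v - Poly_Mapping.lookup k v) =
            real (Poly_Mapping.lookup b v) - real (Poly_Mapping.lookup k v)"
          "real (Poly_Mapping.lookup c v - Poly_Mapping.lookup k v) =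
            real (Poly_Mapping.lookup c v) - real (Poly_Mapping.lookup k v)"
          using k \<open>k \<in> below c\<close> by (simp_all add: below_def of_nat_diff)
        then show ?thesis
          unfolding fst_conv snd_conv lookup_add lookup_minus of_nat_add by (simp add: algebra_simps)
      qed
    qed simp
    then show ?thesis using homogeneous_term by metis
  qed simp
qed

lemma weyl_eq_sum_terms:
  "R = (\<Sum>m\<in>Poly_Mapping.keys (weyl_coeffs R). weyl_term (fst m) (snd m) (weyl_coeff R m))"
proof (rule weyl_eqI)
  fix m
  have "weyl_coeff (\<Sum>m\<in>Poly_Mapping.keys (weyl_coeffs R). weyl_term (fst m) (snd m) (weyl_coeff R m)) m =
     (\<Sum>m'\<in>Poly_Mapping.keys (weyl_coeffs R). if m' = m then weyl_coeff R m else 0)"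
    unfolding weyl_coeff_sum by (rule sum.cong) (auto simp: weyl_coeff_term)
  then show "weyl_coeff R m =
     weyl_coeff (\<Sum>m\<in>Poly_Mapping.keys (weyl_coeffs R). weyl_term (fst m) (snd m) (weyl_coeff R m)) m"
    by (simp add: in_keys_iff)
qed

lemma weyl_times_eq_sum_terms:
  "R * S = (\<Sum>m\<in>Poly_Mapping.keys (weyl_coeffs R). \<Sum>n\<in>Poly_Mapping.keys (weyl_coeffs S).
     weyl_term (fst m) (snd m) (weyl_coeff R m) * weyl_term (fst n) (snd n) (weyl_coeff S n))"
  using arg_cong2[OF weyl_eq_sum_terms[of R] weyl_eq_sum_terms[of S], of "(*)"]
  unfolding sum_product .

lemma homogeneous_times:
  assumes "R \<in> homogeneous w d" "S \<in> homogeneous w e"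
  shows "R * S \<in> homogeneous w (d + e)"
proof (subst weyl_times_eq_sum_terms, intro homogeneous_sum)
  fix m n assume "m \<in> Poly_Mapping.keys (weyl_coeffs R)" "n \<in> Poly_Mapping.keys (weyl_coeffs S)"
  then have "weight w m = d" "weight w n = e"
    using assms unfolding homogeneous_def in_keys_iff by blast+
  then show "weyl_term (fst m) (snd m) (weyl_coeff R m) * weyl_term (fst n) (snd n) (weyl_coeff S n)
      \<in> homogeneous w (d + e)"
    using homogeneous_term_times_term[of "fst m" "snd m" _ "fst n" "snd n" _ w] by simp
qed

lemma component_term_times:
  "component w e (weyl_term a b c * R) = weyl_term a b c * component w (e - weight w (a, b)) R"
proof (induction R rule: weyl_term_induct)
  case (monom a' b' c')
  show ?case
    by (auto simp: component_homogeneous[OF homogeneous_term_times_term]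
        component_homogeneous[OF homogeneous_term])
qed (simp add: component_add distrib_left)

lemma homogeneous_le: "R \<in> homogeneous w d \<Longrightarrow> d \<le> e \<Longrightarrow> R \<in> weight_le w e"
  by (simp add: homogeneous_def weight_le_def)

lemma weight_le_0 [simp]: "0 \<in> weight_le w e"
  by (simp add: weight_le_def)

lemma weight_le_mono: "R \<in> weight_le w d \<Longrightarrow> d \<le> e \<Longrightarrow> R \<in> weight_le w e"
  unfolding weight_le_def mem_Collect_eq by (blast intro: order_trans)

lemma weight_le_add: "R \<in> weight_le w e \<Longrightarrow> S \<in> weight_le w e \<Longrightarrow> R + S \<in> weight_le w e"
proof -
  have "weyl_coeff R m \<noteq> 0 \<or> weyl_coeff S m \<noteq> 0" if "weyl_coeff (R + S) m \<noteq> 0" for m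
    using that by (auto simp: weyl_coeff_add)
  moreover assume "R \<in> weight_le w e" "S \<in> weight_le w e"
  ultimately show ?thesis unfolding weight_le_def by blast
qed

lemma weight_le_sum: "(\<And>a. a \<in> A \<Longrightarrow> F a \<in> weight_le w e) \<Longrightarrow> sum F A \<in> weight_le w e"
  by (induction A rule: infinite_finite_induct) (auto intro: weight_le_add)

lemma weight_le_times:
  assumes "R \<in> weight_le w d" "S \<in> weight_le w e"
  shows "R * S \<in> weight_le w (d + e)"
proof (subst weyl_times_eq_sum_terms, intro weight_le_sum)
  fix m n assume "m \<in> Poly_Mapping.keys (weyl_coeffs R)" "n \<in> Poly_Mapping.keys (weyl_coeffs S)"
  then have "weight w m \<le> d" "weight w n \<le> e"
    using assms unfolding weight_le_def in_keys_iff by blast+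
  then have "weight w (fst m, snd m) + weight w (fst n, snd n) \<le> d + e"
    by (simp add: add_mono)
  then show "weyl_term (fst m) (snd m) (weyl_coeff R m) * weyl_term (fst n) (snd n) (weyl_coeff S n)
      \<in> weight_le w (d + e)"
    by (rule homogeneous_le[OF homogeneous_term_times_term])
qed

text \<open>
  The elements all of whose components are leading components of members of \<open>I\<close> form a left ideal:
  a homogeneous factor shifts components and weight bounds alike.  This left ideal contains the
  initial forms, hence the initial ideal.
\<close>

lemma component_in_initial_ideal:
  assumes I: "left_ideal I" and R: "R \<in> initial_ideal w I"
  obtains S where "S \<in> I" "S \<in> weight_le w e" "component w e S = component w e R"
proof -
  define Z where "Z = {R. \<forall>e. \<exists>S\<in>I. S \<in> weight_le w e \<and> component w e S = component w e R}"
  have "left_ideal Z"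
    unfolding left_ideal_def
  proof (intro conjI ballI allI)
    have "0 \<in> weight_le w e \<and> component w e 0 = component w e 0" for e by simp
    then show "0 \<in> Z" unfolding Z_def using left_ideal_0[OF I] by blast
    show add: "R + S \<in> Z" if "R \<in> Z" "S \<in> Z" for R S
      unfolding Z_def
    proof (safe)
      fix e
      obtain R' S' where "R' \<in> I" "R' \<in> weight_le w e" "component w e R' = component w e R"
        "S' \<in> I" "S' \<in> weight_le w e" "component w e S' = component w e S"
        using \<open>R \<in> Z\<close> \<open>S \<in> Z\<close> unfolding Z_def by blast
      then show "\<exists>T\<in>I. T \<in> weight_le w e \<and> component w e T = component w e (R + S)"
        using I by (intro bexI[of _ "R' + S'"]) (auto simp: component_add left_ideal_add weight_le_add)
    qed
    show "R * S \<in> Z" if S: "S \<in> Z" for R S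
    proof (induction R rule: weyl_term_induct)
      case (monom a b c)
      show ?case unfolding Z_def
      proof safe
        fix e
        obtain T where "T \<in> I" "T \<in> weight_le w (e - weight w (a, b))"
          "component w (e - weight w (a, b)) T = component w (e - weight w (a, b)) S"
          using S unfolding Z_def by blast
        moreover from this(2) have "weyl_term a b c * T \<in> weight_le w e"
          using weight_le_times[OF homogeneous_le[OF homogeneous_term[of a b c] order_refl]] by fastforce
        ultimately show "\<exists>T\<in>I. T \<in> weight_le w e \<and> component w e T = component w e (weyl_term a b c * S)"
          using I by (intro bexI[of _ "weyl_term a b c * T"]) (auto simp: component_term_times left_ideal_times)
      qed
    qed (simp add: distrib_right add)
  qed
  moreover have "initial_form w R \<in> Z" if "R \<in> I" "R \<noteq> 0" for R
    unfolding Z_def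
  proof safe
    fix e
    let ?d = "Max (weight w ` Poly_Mapping.keys (weyl_coeffs R))"
    have "R \<in> weight_le w ?d"
      by (simp add: weight_le_def in_keys_iff)
    moreover have "component w e (initial_form w R) = (if e = ?d then component w ?d R else 0)"
      unfolding initial_form_eq_component by (rule component_homogeneous[OF component_in_homogeneous])
    ultimately show "\<exists>S\<in>I. S \<in> weight_le w e \<and> component w e S = component w e (initial_form w R)"
      using \<open>R \<in> I\<close> I left_ideal_0[OF I] by (cases "e = ?d") (auto intro: bexI[of _ R] bexI[of _ 0])
  qed
  ultimately have "initial_ideal w I \<subseteq> Z"
    unfolding initial_ideal_def by (intro hull_minimal) auto
  then show thesis using that R unfolding Z_def by blast
qed

lemma initial_form_leading:
  assumes "R \<in> homogeneous w e" "R \<noteq> 0" "S \<in> weight_le w d" "d < e"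
  shows "initial_form w (R + S) = R" "R + S \<noteq> 0"
proof -
  have le: "weight w m \<le> d" if "weyl_coeff S m \<noteq> 0" for m
    using assms(3) that unfolding weight_le_def by blast
  have "weyl_coeff S m = 0" if "weight w m = e" for m
    using le[of m] that \<open>d < e\<close> by (cases "weyl_coeff S m = 0") auto
  then have S: "component w e S = 0"
    by (intro weyl_eqI) (simp add: weyl_coeff_component)
  then have comp: "component w e (R + S) = R"
    by (simp add: component_add component_homogeneous[OF assms(1)])
  then show "R + S \<noteq> 0" using \<open>R \<noteq> 0\<close> by auto
  have "R + S \<in> weight_le w e"
    using homogeneous_le[OF assms(1) order_refl] weight_le_mono[OF assms(3)] \<open>d < e\<close>
    by (intro weight_le_add) auto
  then have "weight w m \<le> e" if "m \<in> Poly_Mapping.keys (weyl_coeffs (R + S))" for m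
    using that unfolding weight_le_def in_keys_iff by blast
  moreover obtain m where "weyl_coeff (component w e (R + S)) m \<noteq> 0"
    using comp \<open>R \<noteq> 0\<close> by (metis weyl_coeff_0 weyl_eqI)
  then have "m \<in> Poly_Mapping.keys (weyl_coeffs (R + S))" "weight w m = e"
    by (simp_all add: weyl_coeff_component in_keys_iff split: if_splits)
  ultimately have "Max (weight w ` Poly_Mapping.keys (weyl_coeffs (R + S))) = e"
    by (intro Max_eqI) auto
  then show "initial_form w (R + S) = R" by (simp add: initial_form_eq_component comp)
qed

section \<open>Polynomials inside the Weyl algebra\<close>

definition pvar :: "'n \<Rightarrow> ('k::comm_ring_1, 'n) mpoly"
  where "pvar i = Poly_Mapping.single (Poly_Mapping.single i 1) 1"

lemma mpoly_induct [case_names scalar var add]: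
  fixes p :: "('k::comm_ring_1, 'n::finite) mpoly"
  assumes scalar: "\<And>c. P (Poly_Mapping.single 0 c)"
    and var: "\<And>p i. P p \<Longrightarrow> P (pvar i * p)" and add: "\<And>p q. P p \<Longrightarrow> P q \<Longrightarrow> P (p + q)"
  shows "P p"
proof (induction p rule: pm_induct)
  case (single m c)
  show ?case
  proof (induction m rule: exponent_induct)
    case (add_single m i)
    then show ?case using var[of "Poly_Mapping.single m c" i]
      by (simp add: pvar_def mult_single add.commute)
  qed (rule scalar)
qed (rule add)

lemma pdiff_single_0 [simp]: "pdiff i (Poly_Mapping.single 0 c) = 0"
  by (simp add: pdiff_single)

lemma pdiff_pvar: "pdiff i (pvar j) = (if i = j then 1 else 0)"
  by (simp add: pvar_def pdiff_single lookup_single when_def)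

lemma pdiff_0 [simp]: "pdiff i 0 = 0"
  using pdiff_add[of i 0 0] by simp

lemma pdiff_1 [simp]: "pdiff i 1 = 0"
  using pdiff_single_0[of i 1] by simp

lemma pdiff_commute: "pdiff i (pdiff j p) = pdiff j (pdiff i p)"
proof (induction p rule: pm_induct)
  case (single m c)
  show ?case
  proof (cases "i = j")
    case False
    have "m - Poly_Mapping.single i 1 - Poly_Mapping.single j 1 = m - Poly_Mapping.single j 1 - Poly_Mapping.single i (1::nat)"
      by (rule poly_mapping_eqI) (simp add: lookup_minus diff_commute)
    then show ?thesis
      using False by (simp add: pdiff_single lookup_minus lookup_single mult_ac)
  qed simp
qed (simp add: pdiff_add)

definition lift_exponent :: "('n::finite \<Rightarrow>\<^sub>0 nat) \<Rightarrow> 'n option \<Rightarrow>\<^sub>0 nat"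
  where "lift_exponent \<alpha> = (\<Sum>i\<in>UNIV. Poly_Mapping.single (Some i) (Poly_Mapping.lookup \<alpha> i))"

lemma lift_exponent_0 [simp]: "lift_exponent 0 = 0"
  by (simp add: lift_exponent_def)

lemma lift_exponent_add: "lift_exponent (\<alpha> + \<beta>) = lift_exponent \<alpha> + lift_exponent \<beta>"
  by (simp add: lift_exponent_def lookup_add single_add sum.distrib)

lemma lift_exponent_single: "lift_exponent (Poly_Mapping.single i n) = Poly_Mapping.single (Some i) n"
proof -
  have "lift_exponent (Poly_Mapping.single i n) = (\<Sum>j\<in>UNIV. if j = i then Poly_Mapping.single (Some i) n else 0)"
    unfolding lift_exponent_def by (rule sum.cong) (auto simp: lookup_single)
  then show ?thesis by simp
qed

lemma lookup_lift_exponent_None [simp]: "Poly_Mapping.lookup (lift_exponent \<alpha>) None = 0"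
  by (simp add: lift_exponent_def lookup_sum lookup_single)

lemma poly_to_DY_eq: "poly_to_DY p = pm_extend (\<lambda>\<alpha>. weyl_term (lift_exponent \<alpha>) 0) p"
  by (simp add: poly_to_DY_def pm_extend_def lift_exponent_def)

lemma poly_to_DY_single: "poly_to_DY (Poly_Mapping.single \<alpha> c) = weyl_term (lift_exponent \<alpha>) 0 c"
  by (simp add: poly_to_DY_eq pm_extend_single)

lemma poly_to_DY_add: "poly_to_DY (p + q) = poly_to_DY p + poly_to_DY q"
  by (simp add: poly_to_DY_eq pm_extend_add weyl_term_add)

lemma poly_to_DY_0 [simp]: "poly_to_DY 0 = 0"
  by (simp add: poly_to_DY_eq)

lemma poly_to_DY_scalar: "poly_to_DY (Poly_Mapping.single 0 c) = weyl_term 0 0 c"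
  by (simp add: poly_to_DY_single)

lemma poly_to_DY_1 [simp]: "poly_to_DY 1 = 1"
  using poly_to_DY_scalar[of 1] by simp

lemma poly_to_DY_pvar: "poly_to_DY (pvar i) = weyl_var (Some i)"
  by (simp add: pvar_def poly_to_DY_single lift_exponent_single weyl_var_def)

lemma poly_to_DY_mult: "poly_to_DY (p * q) = poly_to_DY p * poly_to_DY q"
proof (induction p rule: pm_induct)
  case (single m c)
  show ?case
  proof (induction q rule: pm_induct)
    case (single n d)
    show ?case
      by (simp add: mult_single poly_to_DY_single lift_exponent_add weyl_term_times below_0 leibniz_0)
  qed (simp add: distrib_left poly_to_DY_add)
qed (simp add: distrib_right poly_to_DY_add)

lemma poly_to_DY_uminus: "poly_to_DY (- p) = - poly_to_DY p"
  using poly_to_DY_add[of p "- p"] by (simp add: eq_neg_iff_add_eq_0 add.commute)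

lemma commute_product:
  fixes a b c :: "'a::semigroup_mult"
  assumes "a * b = b * a" "a * c = c * a"
  shows "a * (b * c) = b * c * a"
  using assms by (metis mult.assoc)

lemma weyl_scalar_commute: "weyl_term 0 0 c * R = R * weyl_term 0 0 c"
proof (induction R rule: weyl_induct)
  case (scalar d)
  then show ?case by (simp add: weyl_term_times below_0 leibniz_0 mult.commute)
next
  case (var R v)
  have "weyl_term 0 0 c * weyl_var v = weyl_var v * weyl_term 0 0 c"
    by (simp add: weyl_var_def weyl_term_times below_0 leibniz_0)
  then show ?case using var by (rule commute_product)
next
  case (diff R v)
  have "weyl_term 0 0 c * weyl_diff v = weyl_diff v * weyl_term 0 0 c"
    unfolding weyl_diff_times_term by (simp add: weyl_diff_def weyl_scalar_times_term)
  then show ?case using diff by (rule commute_product)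
qed (simp add: distrib_left distrib_right)

lemma weyl_diff_poly:
  "weyl_diff (Some i) * poly_to_DY p = poly_to_DY p * weyl_diff (Some i) + poly_to_DY (pdiff i p)"
proof (induction p rule: mpoly_induct)
  case (scalar c)
  then show ?case by (simp add: poly_to_DY_scalar weyl_scalar_commute)
next
  case (var p j)
  have "weyl_diff (Some i) * poly_to_DY (pvar j * p) =
      weyl_var (Some j) * (weyl_diff (Some i) * poly_to_DY p) + (if i = j then poly_to_DY p else 0)"
    by (simp add: poly_to_DY_mult poly_to_DY_pvar weyl_diff_var distrib_right flip: mult.assoc)
  then show ?case
    by (simp add: var poly_to_DY_mult poly_to_DY_pvar pdiff_mult pdiff_pvar poly_to_DY_add
        distrib_left mult.assoc)
qed (simp add: poly_to_DY_add pdiff_add distrib_left distrib_right add_ac)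

lemma weyl_t_poly: "weyl_var None * poly_to_DY p = poly_to_DY p * weyl_var None"
proof (induction p rule: mpoly_induct)
  case (scalar c)
  then show ?case by (simp add: poly_to_DY_scalar weyl_scalar_commute)
next
  case (var p j)
  with weyl_var_commute show ?case
    unfolding poly_to_DY_mult poly_to_DY_pvar by (rule commute_product)
qed (simp add: poly_to_DY_add distrib_left distrib_right)

lemma weyl_dt_poly: "weyl_diff None * poly_to_DY p = poly_to_DY p * weyl_diff None"
proof (induction p rule: mpoly_induct)
  case (scalar c)
  then show ?case by (simp add: poly_to_DY_scalar weyl_scalar_commute)
next
  case (var p j)
  have "weyl_diff None * weyl_var (Some j) = (weyl_var (Some j) * weyl_diff None :: ('a, 'b option) weyl)"
    by (simp add: weyl_diff_var)
  then show ?case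
    using var unfolding poly_to_DY_mult poly_to_DY_pvar by (rule commute_product)
qed (simp add: poly_to_DY_add distrib_left distrib_right)

lemma weight_w_t:
  fixes a b :: "'n::finite option \<Rightarrow>\<^sub>0 nat"
  shows "weight w_t (a, b) = real (Poly_Mapping.lookup b None) - real (Poly_Mapping.lookup a None)"
proof -
  have "weight w_t (a, b) = (\<Sum>v\<in>(UNIV :: 'n option set). if v = None then
      real (Poly_Mapping.lookup b None) - real (Poly_Mapping.lookup a None) else 0)"
    unfolding weight_def by (rule sum.cong) (auto simp: w_t_def split: option.split)
  then show ?thesis by simp
qed

lemma homogeneous_generators:
  shows "weyl_var (Some i) \<in> homogeneous w_t 0" "weyl_diff (Some i) \<in> homogeneous w_t 0"
    and "weyl_var None \<in> homogeneous w_t (- 1)" "weyl_diff None \<in> homogeneous w_t 1"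
  by (simp_all add: weyl_var_def weyl_diff_def homogeneous_def weyl_coeff_term weight_w_t lookup_single)

lemma homogeneous_poly_to_DY: "poly_to_DY p \<in> homogeneous w_t 0"
proof -
  have "weyl_term (lift_exponent \<alpha>) 0 c \<in> homogeneous w_t 0" for \<alpha> and c :: 'a
    by (simp add: homogeneous_def weyl_coeff_term weight_w_t)
  then show ?thesis
    unfolding poly_to_DY_eq pm_extend_def by (intro homogeneous_sum)
qed

lemma homogeneous_s_in_DY: "s_in_DY \<in> homogeneous w_t 0"
  using homogeneous_times[OF homogeneous_generators(4,3)]
  unfolding s_in_DY_def by (intro homogeneous_uminus) simp

lemma homogeneous_Kxs_to_DY: "Kxs_to_DY p \<in> homogeneous w_t 0"
proof -
  have "1 \<in> homogeneous w_t 0" using homogeneous_poly_to_DY[of 1] by simp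
  then have "s_in_DY ^ i \<in> homogeneous w_t 0" for i
    using homogeneous_times[OF homogeneous_s_in_DY] by (induction i) fastforce+
  then show ?thesis
    using homogeneous_times[OF homogeneous_poly_to_DY] unfolding Kxs_to_DY_def
    by (intro homogeneous_sum) fastforce
qed

section \<open>Differentiating rational functions\<close>

lemma fdiff_Fract:
  assumes "q \<noteq> 0"
  shows "fdiff i (Fract p q) = Fract (pdiff i p * q - p * pdiff i q) (q * q)"
proof -
  have "Fract p q = abs_fract (p, q)"
    and "Fract (pdiff i p * q - p * pdiff i q) (q * q) = abs_fract (pdiff i p * q - p * pdiff i q, q * q)"
    using assms by (simp_all add: Fract_def)
  moreover have "fractrel (p, q) (p, q)" using assms by (simp add: fractrel_def)
  ultimately show ?thesis by (simp add: fdiff.abs_eq)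
qed

lemma fdiff_to_fract: "fdiff i (to_fract p) = to_fract (pdiff i p)"
  by (simp add: to_fract_def fdiff_Fract)

lemma fdiff_0 [simp]: "fdiff i 0 = 0" and fdiff_1 [simp]: "fdiff i 1 = 0"
  using fdiff_to_fract[of i 0] fdiff_to_fract[of i 1] by simp_all

lemma fdiff_mult: "fdiff i (x * y) = fdiff i x * y + x * fdiff i y"
proof -
  obtain p q where "x = Fract p q" "q \<noteq> 0" by (cases x)
  moreover obtain p' q' where "y = Fract p' q'" "q' \<noteq> 0" by (cases y)
  ultimately show ?thesis
    by (simp add: fdiff_Fract pdiff_mult eq_fract algebra_simps)
qed

lemma fdiff_add: "fdiff i (x + y) = fdiff i x + fdiff i y"
proof -
  obtain p q where "x = Fract p q" "q \<noteq> 0" by (cases x)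
  moreover obtain p' q' where "y = Fract p' q'" "q' \<noteq> 0" by (cases y)
  ultimately show ?thesis
    by (simp add: fdiff_Fract pdiff_mult pdiff_add eq_fract algebra_simps)
qed

lemma fdiff_diff: "fdiff i (x - y) = fdiff i x - fdiff i y"
  using fdiff_add[of i "x - y" y] by simp

lemma fdiff_sum: "fdiff i (sum F A) = (\<Sum>a\<in>A. fdiff i (F a))"
  by (induction A rule: infinite_finite_induct) (simp_all add: fdiff_add)

lemma fdiff_inverse:
  assumes "x \<noteq> 0"
  shows "fdiff i (inverse x) = - fdiff i x * inverse x * inverse x"
proof -
  have "fdiff i x * inverse x + x * fdiff i (inverse x) = 0"
    using assms fdiff_mult[of i x "inverse x"] by simp
  then show ?thesis using assms by (simp add: field_simps eq_neg_iff_add_eq_0)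
qed

text \<open>
  The commutator of two derivations is a derivation; vanishing on polynomials, it vanishes on
  quotients.
\<close>

lemma fdiff_commute: "fdiff i (fdiff j x) = fdiff j (fdiff i x)"
proof -
  define \<Delta> where "\<Delta> x = fdiff i (fdiff j x) - fdiff j (fdiff i x)" for x :: "('b, 'a) ratfun"
  obtain p q where x: "x = Fract p q" "q \<noteq> 0" by (cases x)
  have poly: "\<Delta> (to_fract p) = 0" for p
    by (simp add: \<Delta>_def fdiff_to_fract pdiff_commute[of i])
  have "to_fract p = x * to_fract q" using x by (simp add: Fract_conv_to_fract)
  then have "\<Delta> x * to_fract q + x * \<Delta> (to_fract q) = 0"
    using poly[of p] by (simp add: \<Delta>_def fdiff_mult fdiff_add algebra_simps)
  then show ?thesis using x by (simp add: poly) (simp add: \<Delta>_def)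
qed

lemma const_ratfun_eq: "const_ratfun c = to_fract (Poly_Mapping.single 0 c)"
  by (simp add: const_ratfun_def to_fract_def)

lemma fdiff_const_ratfun [simp]: "fdiff i (const_ratfun c) = 0"
  by (simp add: const_ratfun_eq fdiff_to_fract)

abbreviation fdiff_poly ::
  "'n \<Rightarrow> ('k::field_char_0, 'n::linorder) ratfun poly \<Rightarrow> ('k, 'n) ratfun poly"
  where "fdiff_poly i \<equiv> map_poly (fdiff i)"

lemma fdiff_poly_add: "fdiff_poly i (g + h) = fdiff_poly i g + fdiff_poly i h"
  by (rule poly_eqI) (simp add: coeff_map_poly fdiff_add)

lemma fdiff_poly_mult: "fdiff_poly i (g * h) = fdiff_poly i g * h + g * fdiff_poly i h"
  by (rule poly_eqI) (simp add: coeff_map_poly coeff_mult fdiff_sum fdiff_mult sum.distrib)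

lemma fdiff_poly_pCons: "fdiff_poly i (pCons a g) = pCons (fdiff i a) (fdiff_poly i g)"
  by (rule map_poly_pCons) simp

lemma fdiff_poly_commute: "fdiff_poly i (fdiff_poly j g) = fdiff_poly j (fdiff_poly i g)"
  by (rule poly_eqI) (simp add: coeff_map_poly fdiff_commute[of i])

lemma fdiff_poly_smult: "fdiff_poly i (smult c g) = smult (fdiff i c) g + smult c (fdiff_poly i g)"
  by (rule poly_eqI) (simp add: coeff_map_poly fdiff_mult)

section \<open>The action on \<open>K(x)[s] f\<^sup>s\<close>\<close>

definition shift :: "'a::comm_ring_1 \<Rightarrow> 'a poly \<Rightarrow> 'a poly"
  where "shift c g = g \<circ>\<^sub>p [:c, 1:]"

lemma shift_add: "shift c (g + h) = shift c g + shift c h"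
  and shift_mult: "shift c (g * h) = shift c g * shift c h"
  and shift_smult: "shift c (smult a g) = smult a (shift c g)"
  and shift_const: "shift c [:a:] = [:a:]"
  and shift_0 [simp]: "shift c 0 = 0"
  by (simp_all add: shift_def pcompose_add pcompose_mult pcompose_smult)

lemma shift_s: "shift c [:0, 1:] = [:c, 1:]"
  by (simp add: shift_def pcompose_pCons)

lemma shift_pCons: "shift c (pCons a g) = [:a:] + [:c, 1:] * shift c g"
  by (simp add: shift_def pcompose_pCons)

lemma shift_shift: "shift c (shift d g) = shift (c + d) g"
  by (simp add: shift_def flip: pcompose_assoc) (simp add: pcompose_pCons add.commute)

lemma shift_zero [simp]: "shift 0 g = g"
  by (simp add: shift_def)

lemma fdiff_shift: "fdiff i c = 0 \<Longrightarrow> fdiff_poly i (shift c g) = shift c (fdiff_poly i g)"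
  unfolding shift_def
  by (induction g)
     (simp_all add: pcompose_pCons fdiff_poly_add fdiff_poly_smult fdiff_poly_pCons)

lemma fdiff_neg_1 [simp]: "fdiff i (- 1) = 0"
  using fdiff_diff[of i 0 1] by simp

lemma fract_poly_shift: "fract_poly (shift (of_int c) p) = shift (of_int c) (fract_poly p)"
proof -
  have "to_fract (of_nat n) = of_nat n" for n by (induction n) simp_all
  then have c: "to_fract (of_int c) = of_int c" by (cases c) simp_all
  show ?thesis unfolding shift_def
    by (induction p) (simp_all add: pcompose_pCons map_poly_pCons c)
qed

locale nonzero_polynomial =
  fixes f :: "('k::field_char_0, 'n::{finite,linorder}) mpoly"
  assumes f_nonzero [simp]: "f \<noteq> 0"
begin

abbreviation F :: "('k, 'n) ratfun" where "F \<equiv> to_fract f"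

definition logdiff :: "'n \<Rightarrow> ('k, 'n) ratfun"
  where "logdiff i = fdiff i F * inverse F"

lemma logdiff_F [simp]: "logdiff i * F = fdiff i F"
  by (simp add: logdiff_def)

lemma fdiff_logdiff: "fdiff i (logdiff j) = fdiff j (logdiff i)"
  by (simp add: logdiff_def fdiff_mult fdiff_inverse fdiff_commute[of i j] mult_ac)

lemma fs_diff_eq: "fs_diff f i g = fdiff_poly i g + [:0, logdiff i:] * g"
  by (simp add: fs_diff_def logdiff_def fdiff_to_fract Fract_conv_to_fract divide_inverse)

lemma fs_diff_add: "fs_diff f i (g + h) = fs_diff f i g + fs_diff f i h"
  by (simp add: fs_diff_eq fdiff_poly_add smult_add_right algebra_simps)

lemma fs_diff_mult: "fs_diff f i (g * h) = fdiff_poly i g * h + g * fs_diff f i h"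
  unfolding fs_diff_eq fdiff_poly_mult by (simp only: algebra_simps)

lemma fs_diff_smult: "fs_diff f i (smult c g) = smult (fdiff i c) g + smult c (fs_diff f i g)"
  unfolding fs_diff_eq fdiff_poly_smult by (simp add: smult_add_right add.assoc)

lemma fs_diff_commute: "fs_diff f i (fs_diff f j g) = fs_diff f j (fs_diff f i g)"
  unfolding fs_diff_add fs_diff_mult
  unfolding fs_diff_eq fdiff_poly_commute[of i j] fdiff_poly_add fdiff_poly_mult fdiff_poly_pCons
    fdiff_logdiff[of i j]
  by (simp add: algebra_simps)

text \<open>
  On coefficients of \<open>f\<^sup>s\<close>, the variable \<open>t\<close> acts by \<open>s \<mapsto> s + 1\<close>, which turns \<open>f\<^sup>s\<close> into
  \<open>f \<cdot> f\<^sup>s\<close>, and \<open>\<partial>\<^sub>t\<close> acts as \<open>- s t\<^sup>-\<^sup>1\<close>.  Then \<open>- \<partial>\<^sub>t t\<close> is multiplication by \<open>s\<close>.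
\<close>

definition t_op :: "('k, 'n) ratfun poly \<Rightarrow> ('k, 'n) ratfun poly"
  where "t_op g = smult F (shift 1 g)"

definition dt_op :: "('k, 'n) ratfun poly \<Rightarrow> ('k, 'n) ratfun poly"
  where "dt_op g = - smult (inverse F) ([:0, 1:] * shift (- 1) g)"

lemma dt_t: "dt_op (t_op g) = - ([:0, 1:] * g)"
  by (simp add: dt_op_def t_op_def shift_smult shift_shift)

lemma t_dt: "t_op (dt_op g) = - ([:1, 1:] * g)"
proof -
  have "shift 1 (- h) = - shift 1 h" for h :: "('k, 'n) ratfun poly"
    by (simp add: shift_def pcompose_uminus)
  then show ?thesis
    by (simp add: dt_op_def t_op_def shift_smult shift_shift shift_mult shift_s del: mult_pCons_left)
qed

lemma fs_diff_t: "fs_diff f i (t_op g) = t_op (fs_diff f i g)"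
proof -
  have "F * logdiff i = fdiff i F" by (subst mult.commute) simp
  then show ?thesis
    by (simp add: t_op_def fs_diff_eq fdiff_poly_smult shift_add shift_pCons shift_smult fdiff_shift
        smult_add_right)
qed

lemma fs_diff_dt: "fs_diff f i (dt_op g) = dt_op (fs_diff f i g)"
proof -
  \<comment> \<open>It suffices to compare after applying the injective operator \<open>t\<close>, which commutes with \<open>\<partial>\<^sub>i\<close>.\<close>
  have 1: "t_op (fs_diff f i (dt_op g)) = t_op (dt_op (fs_diff f i g))"
    unfolding fs_diff_t[symmetric] unfolding t_dt
    using fs_diff_mult[of i "- [:1, 1:]" g] by (simp add: fdiff_poly_pCons)
  have "inverse F * F = 1" by simp
  then have "smult (inverse F) (shift (- 1) (t_op h)) = h" for h
    by (simp add: t_op_def shift_smult shift_shift)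
  with 1 show ?thesis by metis
qed

definition X_op :: "'n option \<Rightarrow> ('k, 'n) ratfun poly \<Rightarrow> ('k, 'n) ratfun poly"
  where "X_op v = (case v of None \<Rightarrow> t_op | Some i \<Rightarrow> smult (to_fract (pvar i)))"

definition D_op :: "'n option \<Rightarrow> ('k, 'n) ratfun poly \<Rightarrow> ('k, 'n) ratfun poly"
  where "D_op v = (case v of None \<Rightarrow> dt_op | Some i \<Rightarrow> fs_diff f i)"

sublocale DY: weyl_rep "\<lambda>c. smult (const_ratfun c)" X_op D_op
proof
  fix c d :: 'k and g h :: "('k, 'n) ratfun poly" and u v :: "'n option"
  show "smult (const_ratfun c) (g + h) = smult (const_ratfun c) g + smult (const_ratfun c) h"
    by (rule smult_add_right)
  show "smult (const_ratfun (c + d)) g = smult (const_ratfun c) g + smult (const_ratfun d) g"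
    by (simp add: const_ratfun_eq single_add smult_add_left)
  show "smult (const_ratfun c) (smult (const_ratfun d) g) = smult (const_ratfun (c * d)) g"
    by (simp add: const_ratfun_eq mult_single flip: to_fract_mult)
  show "smult (const_ratfun 1) g = g"
    by (simp add: const_ratfun_eq)
  have t_add: "t_op (g + h) = t_op g + t_op h" and dt_add: "dt_op (g + h) = dt_op g + dt_op h"
    by (simp_all add: t_op_def dt_op_def shift_add smult_add_right algebra_simps)
  have t_smult: "t_op (smult c g) = smult c (t_op g)" and dt_smult: "dt_op (smult c g) = smult c (dt_op g)"
    for c g by (simp_all add: t_op_def dt_op_def shift_smult mult.commute)
  show "X_op v (g + h) = X_op v g + X_op v h"
    by (cases v) (simp_all add: X_op_def t_add smult_add_right)
  show "X_op v (smult (const_ratfun c) g) = smult (const_ratfun c) (X_op v g)"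
    by (cases v) (simp_all add: X_op_def t_smult mult.commute)
  show "D_op v (g + h) = D_op v g + D_op v h"
    by (cases v) (simp_all add: D_op_def dt_add fs_diff_add)
  show "D_op v (smult (const_ratfun c) g) = smult (const_ratfun c) (D_op v g)"
    by (cases v) (simp_all add: D_op_def dt_smult fs_diff_smult)
  show "X_op u (X_op v g) = X_op v (X_op u g)"
    by (cases u; cases v) (simp_all add: X_op_def t_smult mult.commute)
  show "D_op u (D_op v g) = D_op v (D_op u g)"
    by (cases u; cases v) (simp_all add: D_op_def fs_diff_dt fs_diff_commute)
  show "D_op u (X_op v g) = X_op v (D_op u g) + (if u = v then g else 0)"
  proof (cases u; cases v)
    assume "u = None" "v = None"
    moreover have "- ([:0, 1:] * g) = - ([:1, 1:] * g) + g" by simp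
    ultimately show ?thesis by (simp only: D_op_def X_op_def option.case dt_t t_dt) simp
  qed (auto simp: D_op_def X_op_def dt_smult fs_diff_t fs_diff_smult fdiff_to_fract pdiff_pvar)
qed

end

section \<open>The ideal \<open>I\<^sub>f\<close> is the annihilator of \<open>f\<^sup>s\<close>\<close>

context nonzero_polynomial
begin

lemma act_generators:
  "DY.act (weyl_var None) g = t_op g" "DY.act (weyl_diff None) g = dt_op g"
  "DY.act (weyl_var (Some i)) g = smult (to_fract (pvar i)) g"
  "DY.act (weyl_diff (Some i)) g = fs_diff f i g"
  by (simp_all add: DY.act_var DY.act_diff X_op_def D_op_def)

lemma act_poly: "DY.act (poly_to_DY p) g = smult (to_fract p) g"
proof (induction p rule: mpoly_induct)
  case (scalar c)
  then show ?case by (simp only: poly_to_DY_scalar DY.act_scalar) (simp add: const_ratfun_eq)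
next
  case (var p i)
  then show ?case by (simp add: poly_to_DY_mult poly_to_DY_pvar DY.act_times act_generators)
qed (simp add: poly_to_DY_add DY.act_add_left smult_add_left)

lemma act_s: "DY.act s_in_DY g = pCons 0 g"
  by (simp add: s_in_DY_def DY.act_uminus_left DY.act_times act_generators dt_t)

lemma act_Kxs: "DY.act (Kxs_to_DY p) g = fract_poly p * g"
proof -
  have pow: "DY.act (s_in_DY ^ i) g = monom 1 i * g" for i
    by (induction i) (simp_all add: DY.act_times act_s monom_Suc)
  have "fract_poly p = (\<Sum>i\<le>degree p. monom (to_fract (coeff p i)) i)"
    by (subst poly_as_sum_of_monoms[symmetric]) (simp add: degree_map_poly coeff_map_poly)
  also have "\<dots> = (\<Sum>i\<le>degree p. smult (to_fract (coeff p i)) (monom 1 i))"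
    by (simp add: smult_monom)
  finally show ?thesis
    by (simp add: Kxs_to_DY_def DY.act_sum_left DY.act_times act_poly pow sum_distrib_right)
qed

lemma left_ideal_I_f: "left_ideal (I_f f)"
  unfolding I_f_def by (rule left_ideal_hull)

lemma I_f_generators:
  "weyl_var None - poly_to_DY f \<in> I_f f"
  "weyl_diff (Some i) + poly_to_DY (pdiff i f) * weyl_diff None \<in> I_f f"
  unfolding I_f_def by (auto intro!: hull_inc)

lemma I_f_annihilates:
  assumes "R \<in> I_f f"
  shows "DY.act R 1 = 0"
proof -
  have "shift c 1 = 1" for c :: "('k, 'n) ratfun" by (simp add: shift_def pcompose_1)
  then have "t_op 1 = smult F 1" "dt_op 1 = [:0, - inverse F:]"
    by (simp_all add: t_op_def dt_op_def one_pCons)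
  moreover have "fs_diff f i 1 = [:0, to_fract (pdiff i f) * inverse F:]" for i
    by (simp add: fs_diff_eq logdiff_def fdiff_to_fract fdiff_poly_pCons one_pCons)
  ultimately have "I_f f \<subseteq> {R. DY.act R 1 = 0}"
    unfolding I_f_def
    by (intro hull_minimal DY.left_ideal_annihilator)
       (auto simp: DY.act_diff_left DY.act_add_left DY.act_times act_generators act_poly)
  then show ?thesis using assms by blast
qed

text \<open>A finitely supported sequence of coefficients, so that additivity comes for free.\<close>

definition normal_form :: "(nat \<Rightarrow>\<^sub>0 ('k, 'n) mpoly) \<Rightarrow> ('k, 'n option) weyl"
  where "normal_form = pm_extend (\<lambda>k p. poly_to_DY p * weyl_diff None ^ k)"

lemma normal_form_add: "normal_form (q + r) = normal_form q + normal_form r"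
  unfolding normal_form_def by (rule pm_extend_add) (simp_all add: poly_to_DY_add distrib_right)

lemma normal_form_single: "normal_form (Poly_Mapping.single k p) = poly_to_DY p * weyl_diff None ^ k"
  by (simp add: normal_form_def pm_extend_single)

lemma dt_pow_poly: "weyl_diff None ^ k * poly_to_DY p = poly_to_DY p * weyl_diff None ^ k"
  by (rule power_commuting_commutes) (rule weyl_dt_poly)

lemma dt_pow_t:
  "weyl_var None * weyl_diff None ^ k =
     (weyl_diff None ^ k * weyl_var None - of_nat k * weyl_diff None ^ (k - 1) :: ('k, 'n option) weyl)"
proof (induction k)
  case (Suc k)
  let ?t = "weyl_var None :: ('k, 'n option) weyl" and ?d = "weyl_diff None :: ('k, 'n option) weyl"
  have td: "?t * ?d = ?d * ?t - 1" by (simp add: weyl_diff_var)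
  have "?t * ?d ^ Suc k = ?d * (?t * ?d ^ k) - ?d ^ k"
    using arg_cong[OF td, of "\<lambda>x. x * ?d ^ k"] by (simp add: left_diff_distrib mult.assoc)
  also have "\<dots> = ?d ^ Suc k * ?t - ?d * (of_nat k * ?d ^ (k - 1)) - ?d ^ k"
    unfolding Suc.IH by (simp add: right_diff_distrib mult.assoc)
  also have "?d * (of_nat k * ?d ^ (k - 1)) = of_nat k * ?d ^ k"
    using mult_of_nat_commute[of k ?d] by (cases k) (simp_all flip: mult.assoc)
  finally show ?case by (simp add: distrib_right)
qed simp

text \<open>
  Modulo \<open>I\<^sub>f\<close>, a factor \<open>t\<close> or \<open>\<partial>\<^sub>i\<close> on the right can be exchanged for \<open>f\<close> or
  \<open>- f\<^sub>i \<partial>\<^sub>t\<close>.  Only the terms \<open>p(x) \<partial>\<^sub>t\<^sup>k\<close> survive.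
\<close>

lemma normal_form_exists: "\<exists>q. R - normal_form q \<in> I_f f"
proof -
  define C where "C = {R. \<exists>q. R - normal_form q \<in> I_f f}"
  note ideal = left_ideal_I_f
  have nf: "poly_to_DY p * weyl_diff None ^ k \<in> C" for p k
    using left_ideal_0[OF ideal] unfolding C_def
    by (auto simp: normal_form_single intro!: exI[of _ "Poly_Mapping.single k p"])
  have zero: "0 \<in> C" using nf[of 0 0] by simp
  have add: "R + S \<in> C" if "R \<in> C" "S \<in> C" for R S
  proof -
    obtain q r where "R - normal_form q \<in> I_f f" "S - normal_form r \<in> I_f f"
      using \<open>R \<in> C\<close> \<open>S \<in> C\<close> unfolding C_def by blast
    then have "R + S - normal_form (q + r) \<in> I_f f"
      using left_ideal_add[OF ideal, of "R - normal_form q" "S - normal_form r"]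
      by (simp add: normal_form_add algebra_simps)
    then show ?thesis unfolding C_def by blast
  qed
  have ideal_C: "R \<in> C" if "R \<in> I_f f" for R
  proof -
    have "R - normal_form 0 \<in> I_f f" using that by (simp add: normal_form_def)
    then show ?thesis unfolding C_def by blast
  qed
  have nat: "of_nat n * (poly_to_DY p * weyl_diff None ^ k) \<in> C" for n p k
    by (induction n) (auto simp: distrib_right intro: zero add nf)
  have lift: "R * S \<in> C" if S: "S \<in> C" and basis: "\<And>p k. R * (poly_to_DY p * weyl_diff None ^ k) \<in> C" for R S
  proof -
    obtain q where q: "S - normal_form q \<in> I_f f" using S unfolding C_def by blast
    have "R * normal_form q \<in> C"
      by (induction q rule: pm_induct)
         (auto simp: normal_form_single normal_form_add distrib_left intro: basis add)
    then show ?thesis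
      using add[OF ideal_C[OF left_ideal_times[OF ideal q, of R]], of "R * normal_form q"]
      by (simp add: right_diff_distrib)
  qed
  have "R \<in> C"
  proof (induction R rule: weyl_induct)
    case (scalar c)
    then show ?case using nf[of "Poly_Mapping.single 0 c" 0] by (simp add: poly_to_DY_scalar)
  next
    case (var R v)
    then show ?case
    proof (rule lift)
      fix p :: "('k, 'n) mpoly" and k
      let ?B = "poly_to_DY p * weyl_diff None ^ k"
      show "weyl_var v * ?B \<in> C"
      proof (cases v)
        case (Some i)
        then show ?thesis
          using nf[of "pvar i * p" k] by (simp add: poly_to_DY_mult poly_to_DY_pvar mult.assoc)
      next
        case None
        have "weyl_var None * ?B = poly_to_DY p * (weyl_var None * weyl_diff None ^ k)"
          by (simp add: weyl_t_poly flip: mult.assoc)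
        also have "\<dots> = ?B * weyl_var None - of_nat k * (poly_to_DY p * weyl_diff None ^ (k - 1))"
          using mult_of_nat_commute[of k "poly_to_DY p"]
          unfolding dt_pow_t by (simp add: right_diff_distrib flip: mult.assoc)
        also have "\<dots> = ?B * (weyl_var None - poly_to_DY f) + poly_to_DY (p * f) * weyl_diff None ^ k
            + of_nat k * (poly_to_DY (- p) * weyl_diff None ^ (k - 1))"
          by (simp add: right_diff_distrib poly_to_DY_mult poly_to_DY_uminus mult.assoc dt_pow_poly)
        also have "\<dots> \<in> C"
          by (intro add ideal_C nf nat left_ideal_times ideal I_f_generators)
        finally show ?thesis using None by simp
      qed
    qed
  next
    case (diff R v)
    then show ?case
    proof (rule lift)
      fix p :: "('k, 'n) mpoly" and k
      let ?B = "poly_to_DY p * weyl_diff None ^ k"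
      show "weyl_diff v * ?B \<in> C"
      proof (cases v)
        case None
        then show ?thesis
          using nf[of p "Suc k"] by (simp add: weyl_dt_poly mult.assoc flip: mult.assoc[of "weyl_diff None"])
      next
        case (Some i)
        have "weyl_diff None ^ k * weyl_diff (Some i) =
            (weyl_diff (Some i) * weyl_diff None ^ k :: ('k, 'n option) weyl)"
          by (rule power_commuting_commutes) (rule weyl_diff_commute)
        then have "weyl_diff (Some i) * ?B = ?B * weyl_diff (Some i) + poly_to_DY (pdiff i p) * weyl_diff None ^ k"
          by (simp add: weyl_diff_poly distrib_right mult.assoc flip: mult.assoc[of "weyl_diff (Some i)"])
        also have "\<dots> = ?B * (weyl_diff (Some i) + poly_to_DY (pdiff i f) * weyl_diff None)
            + poly_to_DY (- (p * pdiff i f)) * weyl_diff None ^ Suc k + poly_to_DY (pdiff i p) * weyl_diff None ^ k"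
        proof -
          have "?B * (poly_to_DY (pdiff i f) * weyl_diff None) =
              poly_to_DY p * (weyl_diff None ^ k * poly_to_DY (pdiff i f)) * weyl_diff None"
            by (simp only: mult.assoc)
          also have "\<dots> = poly_to_DY (p * pdiff i f) * weyl_diff None ^ Suc k"
            by (simp only: dt_pow_poly poly_to_DY_mult mult.assoc power_Suc2)
          finally have "?B * (poly_to_DY (pdiff i f) * weyl_diff None) =
              poly_to_DY (p * pdiff i f) * weyl_diff None ^ Suc k" .
          then show ?thesis by (simp add: distrib_left poly_to_DY_uminus)
        qed
        also have "\<dots> \<in> C"
          by (intro add ideal_C nf left_ideal_times ideal I_f_generators)
        finally show ?thesis using Some by simp
      qed
    qed
  qed (rule add)
  then show ?thesis by (simp add: C_def)
qed

lemma degree_dt_op: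
  assumes "g \<noteq> 0"
  shows "dt_op g \<noteq> 0" "degree (dt_op g) = Suc (degree g)"
proof -
  have "degree (shift (- 1) g) = degree g" by (simp add: shift_def degree_pcompose)
  moreover have "shift (- 1) g \<noteq> 0"
  proof
    assume "shift (- 1) g = 0"
    then have "shift 1 (shift (- 1) g) = 0" by simp
    then show False using assms by (simp add: shift_shift)
  qed
  ultimately show "dt_op g \<noteq> 0" "degree (dt_op g) = Suc (degree g)"
    by (simp_all add: dt_op_def)
qed

text \<open>
  The elements \<open>\<partial>\<^sub>t\<^sup>k f\<^sup>s = (-1)\<^sup>k s (s - 1) \<dots> (s - k + 1) f\<^sup>s\<^sup>-\<^sup>k\<close> have distinct degrees in \<open>s\<close>, so
  they are independent over \<open>K[x]\<close>.
\<close>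

lemma normal_form_faithful:
  assumes "DY.act (normal_form q) 1 = 0"
  shows "q = 0"
proof (rule ccontr)
  assume "q \<noteq> 0"
  then have keys: "Poly_Mapping.keys q \<noteq> {}" by simp
  define \<phi> where "\<phi> k = DY.act (weyl_diff None ^ k) 1" for k
  have \<phi>: "\<phi> k \<noteq> 0 \<and> degree (\<phi> k) = k" for k
    by (induction k) (simp_all add: \<phi>_def DY.act_times act_generators degree_dt_op)
  define K where "K = Max (Poly_Mapping.keys q)"
  have K: "K \<in> Poly_Mapping.keys q" "\<And>k. k \<in> Poly_Mapping.keys q \<Longrightarrow> k \<le> K"
    using keys by (simp_all add: K_def)
  have "0 = coeff (DY.act (normal_form q) 1) K" using assms by simp
  also have "\<dots> = (\<Sum>k\<in>Poly_Mapping.keys q. to_fract (Poly_Mapping.lookup q k) * coeff (\<phi> k) K)"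
    by (simp add: normal_form_def pm_extend_def DY.act_sum_left DY.act_times act_poly \<phi>_def coeff_sum)
  also have "\<dots> = (\<Sum>k\<in>Poly_Mapping.keys q. if k = K then to_fract (Poly_Mapping.lookup q K) * lead_coeff (\<phi> K) else 0)"
  proof (rule sum.cong)
    fix k assume "k \<in> Poly_Mapping.keys q"
    then have "k \<le> K" by (rule K)
    then show "to_fract (Poly_Mapping.lookup q k) * coeff (\<phi> k) K =
        (if k = K then to_fract (Poly_Mapping.lookup q K) * lead_coeff (\<phi> K) else 0)"
      using \<phi>[of k] by (cases "k = K") (auto intro!: coeff_eq_0)
  qed simp
  also have "\<dots> = to_fract (Poly_Mapping.lookup q K) * lead_coeff (\<phi> K)"
    using K(1) by simp
  finally show False
    using K(1) \<phi>[of K] leading_coeff_0_iff[of "\<phi> K"] by (simp add: in_keys_iff)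
qed

lemma I_f_eq_annihilator: "I_f f = {R. DY.act R 1 = 0}"
proof
  show "{R. DY.act R 1 = 0} \<subseteq> I_f f"
  proof safe
    fix R assume R: "DY.act R 1 = 0"
    obtain q where q: "R - normal_form q \<in> I_f f" using normal_form_exists by blast
    then have "DY.act (normal_form q) 1 = 0"
      using I_f_annihilates[OF q] R by (simp add: DY.act_diff_left)
    then have "q = 0" by (rule normal_form_faithful)
    then show "R \<in> I_f f" using q by (simp add: normal_form_def)
  qed
qed (use I_f_annihilates in blast)

end

section \<open>The modules \<open>D\<^sub>X[s] f\<^sup>s\<^sup>+\<^sup>m\<close> and the initial ideal\<close>

context nonzero_polynomial
begin

text \<open>
  This is \<open>D\<^sub>X[s] f\<^sup>s\<^sup>+\<^sup>m\<close>.  Negative \<open>m\<close> are included because \<open>\<partial>\<^sub>t\<close> lowers \<open>m\<close> by one, just as \<open>t\<close>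
  raises it; a homogeneous operator of weight \<open>e\<close> lowers \<open>m\<close> by \<open>e\<close>.
\<close>

inductive_set DX_span :: "int \<Rightarrow> ('k, 'n) ratfun poly set" for m where
  generator: "[:F powi m:] \<in> DX_span m"
| zero: "0 \<in> DX_span m"
| add: "g \<in> DX_span m \<Longrightarrow> h \<in> DX_span m \<Longrightarrow> g + h \<in> DX_span m"
| mult: "g \<in> DX_span m \<Longrightarrow> fract_poly p * g \<in> DX_span m"
| diff: "g \<in> DX_span m \<Longrightarrow> fs_diff f i g \<in> DX_span m"

lemma DX_span_uminus: "g \<in> DX_span m \<Longrightarrow> - g \<in> DX_span m"
  using DX_span.mult[of g m "0 - 1"] unfolding fract_poly_diff by simp

lemma DX_span_sum: "(\<And>a. a \<in> A \<Longrightarrow> G a \<in> DX_span m) \<Longrightarrow> sum G A \<in> DX_span m"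
  by (induction A rule: infinite_finite_induct) (auto intro: DX_span.zero DX_span.add)

lemma DX_span_smult: "g \<in> DX_span m \<Longrightarrow> smult (to_fract q) g \<in> DX_span m"
  using DX_span.mult[of g m "[:q:]"] by (simp add: map_poly_pCons)

lemma op_simps [simp]:
  "X_op None = t_op" "X_op (Some i) = smult (to_fract (pvar i))"
  "D_op None = dt_op" "D_op (Some i) = fs_diff f i"
  by (simp_all add: X_op_def D_op_def fun_eq_iff)

lemma t_op_add: "t_op (g + h) = t_op g + t_op h"
  using DY.X_add[of None] by simp

lemma dt_op_add: "dt_op (g + h) = dt_op g + dt_op h"
  using DY.D_add[of None] by simp

lemma t_op_DX_span: "g \<in> DX_span m \<Longrightarrow> t_op g \<in> DX_span (m + 1)"
proof (induction rule: DX_span.induct)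
  case generator
  have "t_op [:F powi m:] = [:F powi (m + 1):]"
    by (simp add: t_op_def shift_const power_int_add)
  then show ?case by (simp only: DX_span.generator)
next
  case (mult g p)
  have "t_op (fract_poly p * g) = fract_poly (shift 1 p) * t_op g"
    using fract_poly_shift[of 1 p] by (simp add: t_op_def shift_mult)
  then show ?case using mult by (simp only: DX_span.mult)
next
  case (diff g i)
  then show ?case by (simp add: DX_span.diff flip: fs_diff_t)
next
  case zero
  show ?case by (simp add: t_op_def DX_span.zero)
qed (simp add: t_op_add DX_span.add)

lemma dt_op_DX_span: "g \<in> DX_span m \<Longrightarrow> dt_op g \<in> DX_span (m - 1)"
proof (induction rule: DX_span.induct)
  case generator
  have "dt_op [:F powi m:] = fract_poly [:0, - 1:] * [:F powi (m - 1):]"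
    by (simp add: dt_op_def shift_const power_int_diff map_poly_pCons divide_inverse mult.commute)
  then show ?case by (simp only: DX_span.mult DX_span.generator)
next
  case (mult g p)
  have "dt_op (fract_poly p * g) = fract_poly (shift (- 1) p) * dt_op g"
    using fract_poly_shift[of "- 1" p] by (simp add: dt_op_def shift_mult)
  then show ?case using mult by (simp only: DX_span.mult)
next
  case (diff g i)
  then show ?case by (simp add: DX_span.diff flip: fs_diff_dt)
next
  case zero
  show ?case by (simp add: dt_op_def DX_span.zero)
qed (simp add: dt_op_add DX_span.add)

lemma act_term_DX_span:
  "DY.act (weyl_term a b c) 1 \<in> DX_span (int (Poly_Mapping.lookup a None) - int (Poly_Mapping.lookup b None))"
proof -
  have D: "op_pow D_op b 1 \<in> DX_span (- int (Poly_Mapping.lookup b None))"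
  proof (induction b rule: exponent_induct)
    case zero
    then show ?case using DX_span.generator[of 0] by (simp add: one_pCons)
  next
    case (add_single b v)
    show ?case
    proof (cases v)
      case None
      then have "- int (Poly_Mapping.lookup (b + Poly_Mapping.single v 1) None) =
          - int (Poly_Mapping.lookup b None) - 1"
        by (simp add: lookup_add)
      then show ?thesis
        unfolding DY.D_pow using dt_op_DX_span[OF add_single] None by simp
    next
      case (Some i)
      then have "Poly_Mapping.lookup (b + Poly_Mapping.single v 1) None = Poly_Mapping.lookup b None"
        by (simp add: lookup_add lookup_single)
      then show ?thesis
        unfolding DY.D_pow using DX_span.diff[OF add_single, of i] Some by simp
    qed
  qed
  have "op_pow X_op a (op_pow D_op b 1)
      \<in> DX_span (int (Poly_Mapping.lookup a None) - int (Poly_Mapping.lookup b None))"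
  proof (induction a rule: exponent_induct)
    case zero
    then show ?case using D by simp
  next
    case (add_single a v)
    show ?case
    proof (cases v)
      case None
      then have "int (Poly_Mapping.lookup (a + Poly_Mapping.single v 1) None) - int (Poly_Mapping.lookup b None) =
          int (Poly_Mapping.lookup a None) - int (Poly_Mapping.lookup b None) + 1"
        by (simp add: lookup_add)
      then show ?thesis
        unfolding DY.X_pow using t_op_DX_span[OF add_single] None by (simp add: algebra_simps)
    next
      case (Some i)
      then have "Poly_Mapping.lookup (a + Poly_Mapping.single v 1) None = Poly_Mapping.lookup a None"
        by (simp add: lookup_add lookup_single)
      then show ?thesis
        unfolding DY.X_pow using DX_span_smult[OF add_single, of "pvar i"] Some by simp
    qed
  qed
  then show ?thesis unfolding DY.act_term by (simp add: DX_span_smult const_ratfun_eq)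
qed

lemma DX_span_antimono: "g \<in> DX_span (m + int n) \<Longrightarrow> g \<in> DX_span m"
proof (induction rule: DX_span.induct)
  case generator
  have "[:F powi (m + int n):] = fract_poly [:f ^ n:] * [:F powi m:]"
  proof -
    have "to_fract (f ^ n) = F ^ n" by (induction n) simp_all
    then show ?thesis by (simp add: power_int_add map_poly_pCons mult.commute)
  qed
  then show ?case by (simp only: DX_span.mult DX_span.generator)
qed (auto intro: DX_span.intros)

lemma act_negative_weight:
  assumes "R \<in> weight_le w_t (- 1)"
  shows "DY.act R 1 \<in> DX_span 1"
proof -
  have "DY.act (weyl_term (fst m) (snd m) (weyl_coeff R m)) 1 \<in> DX_span 1"
    if "m \<in> Poly_Mapping.keys (weyl_coeffs R)" for m
  proof -
    obtain a b where m: "m = (a, b)" by (cases m)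
    have "weight w_t m \<le> - 1"
      using assms that unfolding weight_le_def in_keys_iff by blast
    then have "Poly_Mapping.lookup b None + 1 \<le> Poly_Mapping.lookup a None"
      by (simp add: m weight_w_t)
    then obtain n where "Poly_Mapping.lookup a None = Poly_Mapping.lookup b None + 1 + n"
      using le_Suc_ex by blast
    then have "int (Poly_Mapping.lookup a None) - int (Poly_Mapping.lookup b None) = 1 + int n"
      by simp
    then show ?thesis
      using act_term_DX_span[of a b "weyl_coeff R m"] by (auto simp: m intro: DX_span_antimono)
  qed
  then have "(\<Sum>m\<in>Poly_Mapping.keys (weyl_coeffs R). DY.act (weyl_term (fst m) (snd m) (weyl_coeff R m)) 1)
      \<in> DX_span 1"
    by (rule DX_span_sum)
  then show ?thesis by (simp flip: DY.act_sum_left weyl_eq_sum_terms)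
qed

lemma DX_span_negative_weight:
  "g \<in> DX_span 1 \<Longrightarrow> \<exists>R \<in> weight_le w_t (- 1). DY.act R 1 = g"
proof (induction rule: DX_span.induct)
  case generator
  have "DY.act (weyl_var None) 1 = [:F powi 1:]"
    by (simp add: act_generators t_op_def shift_def pcompose_1 one_pCons)
  then show ?case using homogeneous_le[OF homogeneous_generators(3) order_refl] by blast
next
  case zero
  show ?case by (rule bexI[of _ 0]) simp_all
next
  case (add g h)
  then show ?case using weight_le_add DY.act_add_left by metis
next
  case (mult g p)
  then obtain R where R: "R \<in> weight_le w_t (- 1)" "DY.act R 1 = g" by blast
  have "Kxs_to_DY p * R \<in> weight_le w_t (0 + - 1)"
    by (rule weight_le_times[OF homogeneous_le[OF homogeneous_Kxs_to_DY order_refl] R(1)])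
  then show ?case using R(2)
    by (intro bexI[of _ "Kxs_to_DY p * R"]) (simp_all add: DY.act_times act_Kxs)
next
  case (diff g i)
  then obtain R where R: "R \<in> weight_le w_t (- 1)" "DY.act R 1 = g" by blast
  have "weyl_diff (Some i) * R \<in> weight_le w_t (0 + - 1)"
    by (rule weight_le_times[OF homogeneous_le[OF homogeneous_generators(2) order_refl] R(1)])
  then show ?case using R(2)
    by (intro bexI[of _ "weyl_diff (Some i) * R"]) (simp_all add: DY.act_times act_generators)
qed

lemma weight_le_minus_component:
  fixes S :: "('k, 'n option) weyl"
  assumes "S \<in> weight_le w_t 0"
  shows "S - component w_t 0 S \<in> weight_le w_t (- 1)"
  unfolding weight_le_def
proof safe
  fix a b :: "'n option \<Rightarrow>\<^sub>0 nat"
  assume "weyl_coeff (S - component w_t 0 S) (a, b) \<noteq> 0"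
  then have "weyl_coeff S (a, b) \<noteq> 0" "weight w_t (a, b) \<noteq> 0"
    by (auto simp: weyl_coeff_diff weyl_coeff_component split: if_splits)
  moreover have "weight w_t (a, b) \<le> 0"
    using assms \<open>weyl_coeff S (a, b) \<noteq> 0\<close> unfolding weight_le_def by blast
  ultimately show "weight w_t (a, b) \<le> - 1"
    by (simp add: weight_w_t)
qed

text \<open>
  An element of \<open>I\<^sub>f\<close> with leading component \<open>p(x, s)\<close> of weight \<open>0\<close> is \<open>p(x, s) + R\<close> with \<open>R\<close> of
  negative weight, and it annihilates \<open>f\<^sup>s\<close>.  So \<open>p f\<^sup>s = - R f\<^sup>s\<close>, and operators of negative weight
  applied to \<open>f\<^sup>s\<close> fill exactly \<open>D\<^sub>X[s] f\<^sup>s\<^sup>+\<^sup>1\<close>.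
\<close>

lemma in_initial_ideal_iff:
  "Kxs_to_DY p \<in> initial_ideal w_t (I_f f) \<longleftrightarrow> fract_poly p \<in> DX_span 1"
proof
  assume "Kxs_to_DY p \<in> initial_ideal w_t (I_f f)"
  then obtain S where S: "S \<in> I_f f" "S \<in> weight_le w_t 0"
    "component w_t 0 S = component w_t 0 (Kxs_to_DY p)"
    using component_in_initial_ideal[OF left_ideal_I_f] by blast
  have "component w_t 0 S = Kxs_to_DY p"
    using S(3) by (simp add: component_homogeneous[OF homogeneous_Kxs_to_DY])
  then have "DY.act (S - Kxs_to_DY p) 1 \<in> DX_span 1"
    using act_negative_weight[OF weight_le_minus_component[OF S(2)]] by simp
  moreover have "DY.act S 1 = 0" using S(1) by (rule I_f_annihilates)
  ultimately have "- fract_poly p \<in> DX_span 1"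
    by (simp add: DY.act_diff_left act_Kxs)
  then show "fract_poly p \<in> DX_span 1" using DX_span_uminus by fastforce
next
  assume "fract_poly p \<in> DX_span 1"
  then obtain R where R: "R \<in> weight_le w_t (- 1)" "DY.act R 1 = - fract_poly p"
    using DX_span_negative_weight DX_span_uminus by blast
  then have "Kxs_to_DY p + R \<in> I_f f"
    by (simp add: I_f_eq_annihilator DY.act_add_left act_Kxs)
  moreover have "initial_form w_t (Kxs_to_DY p + R) = Kxs_to_DY p" "Kxs_to_DY p + R \<noteq> 0"
    if "Kxs_to_DY p \<noteq> 0"
    using initial_form_leading[OF homogeneous_Kxs_to_DY that R(1)] by auto
  ultimately show "Kxs_to_DY p \<in> initial_ideal w_t (I_f f)"
    unfolding initial_ideal_def
    by (cases "Kxs_to_DY p = 0") (auto simp: left_ideal_0[OF left_ideal_hull] intro!: hull_inc exI)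
qed

end

section \<open>Local functional equations\<close>

lemma const_ratfun_0 [simp]: "const_ratfun 0 = 0" and const_ratfun_1 [simp]: "const_ratfun 1 = 1"
  and const_ratfun_add: "const_ratfun (c + d) = const_ratfun c + const_ratfun d"
  and const_ratfun_mult: "const_ratfun (c * d) = const_ratfun c * const_ratfun d"
  by (simp_all add: const_ratfun_eq single_add mult_single flip: to_fract_add to_fract_mult)

lemma const_ratfun_sum: "const_ratfun (sum F A) = (\<Sum>a\<in>A. const_ratfun (F a))"
  by (induction A rule: infinite_finite_induct) (simp_all add: const_ratfun_add)

lemma const_poly_add:
  "map_poly const_ratfun (p + q) = map_poly const_ratfun p + map_poly const_ratfun q"
  by (rule poly_eqI) (simp add: coeff_map_poly const_ratfun_add)

lemma const_poly_mult:
  "map_poly const_ratfun (p * q) = map_poly const_ratfun p * map_poly const_ratfun q"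
  by (rule poly_eqI) (simp add: coeff_map_poly coeff_mult const_ratfun_sum const_ratfun_mult)

lemma const_poly_eq_fract_poly:
  "map_poly const_ratfun p = fract_poly (map_poly (Poly_Mapping.single 0) p)"
  by (rule poly_eqI) (simp add: coeff_map_poly const_ratfun_eq)

locale nonzero_polynomial_at_prime = nonzero_polynomial f
  for f :: "('k::field_char_0, 'n::{finite,linorder}) mpoly" +
  fixes P :: "('k, 'n) mpoly set"
  assumes prime: "prime_ideal P"
begin

lemma zero_in_P: "0 \<in> P" and one_notin_P: "1 \<notin> P"
  and mult_notin_P: "c \<notin> P \<Longrightarrow> d \<notin> P \<Longrightarrow> c * d \<notin> P"
proof -
  show "0 \<in> P" using prime by (simp add: prime_ideal_def left_ideal_0)
  show "1 \<notin> P"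
  proof
    assume "1 \<in> P"
    then have "r * 1 \<in> P" for r using prime left_ideal_times unfolding prime_ideal_def by blast
    then show False using prime by (auto simp: prime_ideal_def)
  qed
  show "c \<notin> P \<Longrightarrow> d \<notin> P \<Longrightarrow> c * d \<notin> P" using prime by (auto simp: prime_ideal_def)
qed

lemma localization_iff: "x \<in> localization P \<longleftrightarrow> (\<exists>a c. c \<notin> P \<and> to_fract c * x = to_fract a)"
proof -
  have "x = Fract a c \<longleftrightarrow> to_fract c * x = to_fract a" if "c \<notin> P" for a c
  proof -
    have "c \<noteq> 0" using that zero_in_P by auto
    then show ?thesis by (auto simp: Fract_conv_to_fract field_simps)
  qed
  then show ?thesis unfolding localization_def by blast
qed

lemma localization_to_fract: "to_fract a \<in> localization P"
  unfolding localization_iff using one_notin_P by (intro exI[of _ a] exI[of _ 1]) simp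

lemma localization_0: "0 \<in> localization P"
  using localization_to_fract[of 0] by simp

lemma localization_inverse:
  assumes "d \<notin> P"
  shows "inverse (to_fract d) \<in> localization P"
proof -
  have "d \<noteq> 0" using assms zero_in_P by auto
  then have "to_fract d * inverse (to_fract d) = to_fract 1" by simp
  then show ?thesis unfolding localization_iff using assms by blast
qed

lemma localization_add:
  assumes "x \<in> localization P" "y \<in> localization P"
  shows "x + y \<in> localization P"
proof -
  obtain a c a' c' where "c \<notin> P" "to_fract c * x = to_fract a" "c' \<notin> P" "to_fract c' * y = to_fract a'"
    using assms unfolding localization_iff by blast
  moreover from this have "to_fract (c * c') * (x + y) = to_fract (c' * a + c * a')"
    by (simp add: algebra_simps)
  ultimately show ?thesis unfolding localization_iff using mult_notin_P by blast
qed

lemma localization_mult: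
  assumes "x \<in> localization P" "y \<in> localization P"
  shows "x * y \<in> localization P"
proof -
  obtain a c a' c' where "c \<notin> P" "to_fract c * x = to_fract a" "c' \<notin> P" "to_fract c' * y = to_fract a'"
    using assms unfolding localization_iff by blast
  moreover have "to_fract (c * c') * (x * y) = (to_fract c * x) * (to_fract c' * y)"
    by (simp add: mult_ac)
  ultimately have "to_fract (c * c') * (x * y) = to_fract (a * a')" "c * c' \<notin> P"
    by (simp_all add: mult_notin_P)
  then show ?thesis unfolding localization_iff by blast
qed

lemma localization_fdiff:
  assumes "x \<in> localization P"
  shows "fdiff i x \<in> localization P"
proof -
  obtain a c where "c \<notin> P" "x = Fract a c" using assms by (auto simp: localization_def)
  moreover have "c \<noteq> 0" using \<open>c \<notin> P\<close> zero_in_P by auto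
  ultimately show ?thesis
    using mult_notin_P[of c c] by (auto simp: fdiff_Fract localization_def)
qed

definition local_polys :: "('k, 'n) ratfun poly set"
  where "local_polys = {q. \<forall>j. coeff q j \<in> localization P}"

lemma local_operators_iff: "Q \<in> local_operators P \<longleftrightarrow> (\<forall>b. Poly_Mapping.lookup Q b \<in> local_polys)"
  by (simp add: local_operators_def local_polys_def)

lemma local_polys_add: "p \<in> local_polys \<Longrightarrow> q \<in> local_polys \<Longrightarrow> p + q \<in> local_polys"
  by (simp add: local_polys_def localization_add)

lemma local_polys_mult:
  assumes "p \<in> local_polys" "q \<in> local_polys"
  shows "p * q \<in> local_polys"
proof -
  have sum: "sum G A \<in> localization P" if "\<And>a. a \<in> A \<Longrightarrow> G a \<in> localization P" for G and A :: "nat set"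
    using that by (induction A rule: infinite_finite_induct) (auto simp: localization_0 localization_add)
  show ?thesis
    using assms unfolding local_polys_def by (auto simp: coeff_mult intro!: sum localization_mult)
qed

lemma local_polys_fract_poly: "fract_poly p \<in> local_polys"
  by (simp add: local_polys_def coeff_map_poly localization_to_fract)

lemma local_polys_0: "0 \<in> local_polys"
  using local_polys_fract_poly[of 0] by simp

lemma local_polys_fdiff: "p \<in> local_polys \<Longrightarrow> fdiff_poly i p \<in> local_polys"
  by (simp add: local_polys_def coeff_map_poly localization_fdiff)

lemma fs_act_eq: "fs_act f Q g = pm_extend (\<lambda>b q. q * fs_diff_pow f b g) Q"
  by (simp add: fs_act_def pm_extend_def)

lemma fs_act_single: "fs_act f (Poly_Mapping.single b q) g = q * fs_diff_pow f b g"
  by (simp add: fs_act_eq pm_extend_single)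

lemma fs_act_add: "fs_act f (Q + R) g = fs_act f Q g + fs_act f R g"
  by (simp add: fs_act_eq pm_extend_add distrib_right)

lemma fs_diff_pow_add_single:
  "fs_diff_pow f (b + Poly_Mapping.single i 1) g = fs_diff f i (fs_diff_pow f b g)"
  unfolding fs_diff_pow_eq_op_pow by (rule op_pow_add_single) (rule fs_diff_commute)

lemma fs_diff_pow_DX_span: "g \<in> DX_span m \<Longrightarrow> fs_diff_pow f b g \<in> DX_span m"
  by (induction b rule: exponent_induct)
     (simp_all only: fs_diff_pow_add_single DX_span.diff fs_diff_pow_eq_op_pow[of f 0] op_pow_0)

text \<open>The localization of \<open>D\<^sub>X[s] f\<^sup>s\<^sup>+\<^sup>1\<close> at \<open>P\<close>.\<close>

definition local_span :: "('k, 'n) ratfun poly set"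
  where "local_span = {h. \<exists>d. d \<notin> P \<and> smult (to_fract d) h \<in> DX_span 1}"

lemma local_span_0: "0 \<in> local_span"
  using one_notin_P DX_span.zero by (auto simp: local_span_def)

lemma local_span_add:
  assumes "g \<in> local_span" "h \<in> local_span"
  shows "g + h \<in> local_span"
proof -
  obtain c d where "c \<notin> P" "smult (to_fract c) g \<in> DX_span 1" "d \<notin> P" "smult (to_fract d) h \<in> DX_span 1"
    using assms unfolding local_span_def by blast
  then have "smult (to_fract d) (smult (to_fract c) g) + smult (to_fract c) (smult (to_fract d) h) \<in> DX_span 1"
    by (auto intro!: DX_span.add DX_span_smult[of "smult _ _"] simp del: smult_smult)
  then have "smult (to_fract (c * d)) (g + h) \<in> DX_span 1"
    by (simp add: smult_add_right mult.commute)
  then show ?thesis unfolding local_span_def using mult_notin_P \<open>c \<notin> P\<close> \<open>d \<notin> P\<close> by blast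
qed

lemma local_span_sum: "(\<And>a. a \<in> A \<Longrightarrow> G a \<in> local_span) \<Longrightarrow> sum G A \<in> local_span"
  by (induction A rule: infinite_finite_induct) (auto intro: local_span_0 local_span_add)

lemma local_span_mult:
  assumes "h \<in> local_span"
  shows "fract_poly p * h \<in> local_span"
proof -
  obtain d where "d \<notin> P" "smult (to_fract d) h \<in> DX_span 1"
    using assms unfolding local_span_def by blast
  moreover from this(2) have "smult (to_fract d) (fract_poly p * h) \<in> DX_span 1"
    using DX_span.mult[of "smult (to_fract d) h" 1 p] by simp
  ultimately show ?thesis unfolding local_span_def by blast
qed

text \<open>Denominators are cleared one coefficient at a time; a sum needs only their product.\<close>

lemma local_poly_times_DX_span:
  assumes "q \<in> local_polys" "g \<in> DX_span 1"
  shows "q * g \<in> local_span"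
proof -
  have "(\<Sum>j\<le>degree q. monom (coeff q j) j * g) \<in> local_span"
  proof (rule local_span_sum)
    fix j
    obtain a c where c: "c \<notin> P" "to_fract c * coeff q j = to_fract a"
      using assms(1) unfolding local_polys_def localization_iff by blast
    have "smult (to_fract c) (monom (coeff q j) j * g) = fract_poly (monom a j) * g"
      by (simp add: map_poly_monom smult_monom c flip: mult_smult_left)
    then show "monom (coeff q j) j * g \<in> local_span"
      using DX_span.mult[OF assms(2), of "monom a j"] c(1) by (auto simp: local_span_def)
  qed
  then show ?thesis by (simp add: poly_as_sum_of_monoms flip: sum_distrib_right)
qed

definition operator_values :: "('k, 'n) ratfun poly set"
  where "operator_values = {fs_act f Q [:F:] | Q. Q \<in> local_operators P}"

lemma operator_values_add:
  assumes "g \<in> operator_values" "h \<in> operator_values"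
  shows "g + h \<in> operator_values"
proof -
  obtain Q R where "Q \<in> local_operators P" "g = fs_act f Q [:F:]"
    "R \<in> local_operators P" "h = fs_act f R [:F:]"
    using assms unfolding operator_values_def by blast
  moreover from this have "Q + R \<in> local_operators P"
    by (simp add: local_operators_iff lookup_add local_polys_add)
  ultimately show ?thesis
    unfolding operator_values_def using fs_act_add by (metis (mono_tags, lifting) mem_Collect_eq)
qed

lemma operator_values_monomial:
  assumes "q \<in> local_polys"
  shows "q * fs_diff_pow f b [:F:] \<in> operator_values"
proof -
  have "Poly_Mapping.single b q \<in> local_operators P"
    using assms by (auto simp: local_operators_iff lookup_single when_def local_polys_0)
  then show ?thesis unfolding operator_values_def by (auto simp flip: fs_act_single)
qed

lemma operator_values_sum: "(\<And>a. a \<in> A \<Longrightarrow> G a \<in> operator_values) \<Longrightarrow> sum G A \<in> operator_values"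
proof (induction A rule: infinite_finite_induct)
  case empty
  then show ?case using operator_values_monomial[OF local_polys_0] by simp
next
  case (infinite A)
  then show ?case using operator_values_monomial[OF local_polys_0] by simp
qed (auto intro: operator_values_add)

lemma operator_values_mult:
  assumes "p \<in> local_polys" "g \<in> operator_values"
  shows "p * g \<in> operator_values"
proof -
  obtain Q where "Q \<in> local_operators P" "g = fs_act f Q [:F:]"
    using assms(2) unfolding operator_values_def by blast
  then have "p * g = (\<Sum>b\<in>Poly_Mapping.keys Q. (p * Poly_Mapping.lookup Q b) * fs_diff_pow f b [:F:])"
    by (simp add: fs_act_def sum_distrib_left mult.assoc)
  also have "\<dots> \<in> operator_values"
    using \<open>Q \<in> local_operators P\<close> assms(1)
    by (intro operator_values_sum operator_values_monomial local_polys_mult) (auto simp: local_operators_iff)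
  finally show ?thesis .
qed

lemma operator_values_diff:
  assumes "g \<in> operator_values"
  shows "fs_diff f i g \<in> operator_values"
proof -
  obtain Q where Q: "Q \<in> local_operators P" "g = fs_act f Q [:F:]"
    using assms unfolding operator_values_def by blast
  have "fs_diff f i (sum G A) = (\<Sum>b\<in>A. fs_diff f i (G b))" for G and A :: "('n \<Rightarrow>\<^sub>0 nat) set"
    by (induction A rule: infinite_finite_induct) (simp_all add: fs_diff_add, simp_all add: fs_diff_eq)
  then have "fs_diff f i g = (\<Sum>b\<in>Poly_Mapping.keys Q.
      fdiff_poly i (Poly_Mapping.lookup Q b) * fs_diff_pow f b [:F:]
      + Poly_Mapping.lookup Q b * fs_diff_pow f (b + Poly_Mapping.single i 1) [:F:])"
    unfolding Q(2) fs_act_def fs_diff_pow_add_single by (simp only: fs_diff_mult)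
  also have "\<dots> \<in> operator_values"
    using Q(1) by (intro operator_values_sum operator_values_add operator_values_monomial local_polys_fdiff)
      (auto simp: local_operators_iff)
  finally show ?thesis .
qed

text \<open>
  The set of values is itself stable under \<open>K[x,s]\<close> and \<open>\<partial>\<^sub>i\<close>, because moving \<open>\<partial>\<^sub>i\<close> past a local
  coefficient leaves a local coefficient.
\<close>

lemma DX_span_operator_values: "g \<in> DX_span 1 \<Longrightarrow> g \<in> operator_values"
proof (induction rule: DX_span.induct)
  case generator
  have "1 \<in> local_polys" using local_polys_fract_poly[of 1] by simp
  then show ?case
    using operator_values_monomial[of 1 0] by (simp add: fs_diff_pow_eq_op_pow)
next
  case zero
  then show ?case using operator_values_sum[of "{}"] by simp
qed (auto intro: operator_values_add operator_values_mult local_polys_fract_poly operator_values_diff)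

lemma operator_values_eq: "operator_values = local_span"
proof
  show "operator_values \<subseteq> local_span"
  proof
    fix g assume "g \<in> operator_values"
    then obtain Q where "Q \<in> local_operators P" "g = fs_act f Q [:F:]"
      unfolding operator_values_def by blast
    moreover have "[:F:] \<in> DX_span 1" using DX_span.generator[of 1] by simp
    ultimately show "g \<in> local_span"
      by (auto simp: fs_act_def local_operators_iff
          intro!: local_span_sum local_poly_times_DX_span fs_diff_pow_DX_span)
  qed
  show "local_span \<subseteq> operator_values"
  proof
    fix g assume "g \<in> local_span"
    then obtain d where d: "d \<notin> P" "smult (to_fract d) g \<in> DX_span 1"
      unfolding local_span_def by blast
    have "[:inverse (to_fract d):] \<in> local_polys"
      using localization_inverse[OF d(1)] by (auto simp: local_polys_def coeff_pCons localization_0 split: nat.split)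
    then have "[:inverse (to_fract d):] * smult (to_fract d) g \<in> operator_values"
      using DX_span_operator_values[OF d(2)] by (rule operator_values_mult)
    moreover have "to_fract d \<noteq> 0" using d(1) zero_in_P by auto
    ultimately show "g \<in> operator_values" by simp
  qed
qed

lemma local_functional_equation_iff_span:
  "local_functional_equation f P c \<longleftrightarrow> map_poly const_ratfun c \<in> local_span"
  unfolding operator_values_eq[symmetric]
  by (simp add: local_functional_equation_def operator_values_def flip: to_fract_def) metis

lemma local_functional_equation_iff_in_initial_ideal:
  "local_functional_equation f P c \<longleftrightarrow>
    (\<exists>d. d \<notin> P \<and> Kxs_to_DY (smult d (map_poly (Poly_Mapping.single 0) c)) \<in> initial_ideal w_t (I_f f))"
  by (simp add: local_functional_equation_iff_span local_span_def in_initial_ideal_iff const_poly_eq_fract_poly)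

lemma local_functional_equation_add:
  "local_functional_equation f P c \<Longrightarrow> local_functional_equation f P d \<Longrightarrow> local_functional_equation f P (c + d)"
  by (simp add: local_functional_equation_iff_span const_poly_add local_span_add)

lemma local_functional_equation_mult:
  "local_functional_equation f P c \<Longrightarrow> local_functional_equation f P (a * c)"
  unfolding local_functional_equation_iff_span const_poly_mult const_poly_eq_fract_poly[of a]
  by (rule local_span_mult)

lemma local_functional_equation_monic:
  assumes "local_functional_equation f P c" "c \<noteq> 0"
  obtains c' where "local_functional_equation f P c'" "lead_coeff c' = 1" "degree c' = degree c"
proof
  show "local_functional_equation f P ([:inverse (lead_coeff c):] * c)"
    using assms(1) by (rule local_functional_equation_mult)
qed (use assms(2) in simp_all)

text \<open>
  The polynomials with a functional equation form an ideal of \<open>K[s]\<close>, and division with remainder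
  makes an element of least degree a generator.
\<close>

lemma is_local_bs_poly_dvd:
  assumes b: "is_local_bs_poly f P b" and c: "local_functional_equation f P c"
  shows "b dvd c"
proof (rule ccontr)
  assume "\<not> b dvd c"
  then have nz: "c mod b \<noteq> 0" by (simp add: dvd_eq_mod_eq_0)
  have "b \<noteq> 0" using b by (auto simp: is_local_bs_poly_def)
  have "c mod b = c + (- (c div b)) * b"
    by (simp add: minus_div_mult_eq_mod flip: diff_conv_add_uminus)
  then have "local_functional_equation f P (c mod b)"
    using b c by (simp only: is_local_bs_poly_def local_functional_equation_add local_functional_equation_mult)
  then obtain c' where "local_functional_equation f P c'" "lead_coeff c' = 1" "degree c' = degree (c mod b)"
    using nz by (rule local_functional_equation_monic)
  then show False
    using b degree_mod_less[OF \<open>b \<noteq> 0\<close>, of c] nz unfolding is_local_bs_poly_def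
    by (metis not_less)
qed

lemma is_local_bs_poly_exists:
  assumes "local_functional_equation f P c" "c \<noteq> 0"
  shows "\<exists>b. is_local_bs_poly f P b"
proof -
  obtain c' where "local_functional_equation f P c'" "lead_coeff c' = 1"
    using assms by (rule local_functional_equation_monic)
  then show ?thesis
    using ex_has_least_nat[of "\<lambda>b. lead_coeff b = 1 \<and> local_functional_equation f P b" c' degree]
    unfolding is_local_bs_poly_def by blast
qed

text \<open>
  If no nonzero polynomial has a functional equation, then the local Bernstein--Sato polynomial is
  \<open>0\<close> by convention and both sides are false.
\<close>

lemma local_bs_poly_dvd_iff:
  assumes "c \<noteq> 0"
  shows "local_bs_poly f P dvd c \<longleftrightarrow> local_functional_equation f P c"
proof (cases "\<exists>b. is_local_bs_poly f P b")
  case True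
  then obtain b where b: "is_local_bs_poly f P b" by blast
  have "b' = b" if b': "is_local_bs_poly f P b'" for b'
  proof -
    obtain a where a: "b = b' * a"
      using is_local_bs_poly_dvd[OF b'] b unfolding is_local_bs_poly_def by (meson dvdE)
    have "lead_coeff b = 1" "lead_coeff b' = 1" "degree b \<le> degree b'"
      using b b' by (auto simp: is_local_bs_poly_def)
    then have "lead_coeff a = 1" "b' \<noteq> 0"
      using a lead_coeff_mult[of b' a] by auto
    then have "degree b = degree b' + degree a"
      unfolding a by (intro degree_mult_eq) auto
    then have "degree a = 0" using \<open>degree b \<le> degree b'\<close> by simp
    then have "a = 1" using \<open>lead_coeff a = 1\<close> by (auto elim!: degree_eq_zeroE simp: one_pCons)
    then show "b' = b" using a by simp
  qed
  then have "local_bs_poly f P = b"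
    unfolding local_bs_poly_def using b by (metis (mono_tags, lifting) the_equality)
  moreover have "local_functional_equation f P c" if "b dvd c"
  proof -
    obtain a where "c = a * b" using \<open>b dvd c\<close> by (metis dvdE mult.commute)
    then show ?thesis using b by (simp add: is_local_bs_poly_def local_functional_equation_mult)
  qed
  ultimately show ?thesis using is_local_bs_poly_dvd[OF b] by blast
next
  case False
  then show ?thesis
    using is_local_bs_poly_exists assms by (auto simp: local_bs_poly_def)
qed

end

section \<open>Groebner bases for an order that eliminates \<open>s\<close>\<close>

lemma lookup_single_times:
  fixes p :: "'a::cancel_comm_monoid_add \<Rightarrow>\<^sub>0 'b::comm_semiring_0"
  shows "Poly_Mapping.lookup (Poly_Mapping.single u c * p) (u + v) = c * Poly_Mapping.lookup p v"
  by (induction p rule: pm_induct)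
     (simp_all add: mult_single lookup_single when_def distrib_left lookup_add)

lemma finite_xs_monoms: "finite (xs_monoms p)"
proof (rule finite_subset)
  show "xs_monoms p \<subseteq> (\<Union>i\<le>degree p. (\<lambda>\<alpha>. (\<alpha>, i)) ` Poly_Mapping.keys (coeff p i))"
  proof
    fix m assume "m \<in> xs_monoms p"
    then obtain \<alpha> i where "m = (\<alpha>, i)" "Poly_Mapping.lookup (coeff p i) \<alpha> \<noteq> 0"
      by (auto simp: xs_monoms_def)
    moreover from this(2) have "coeff p i \<noteq> 0" by auto
    then have "i \<le> degree p" by (rule le_degree)
    ultimately show "m \<in> (\<Union>i\<le>degree p. (\<lambda>\<alpha>. (\<alpha>, i)) ` Poly_Mapping.keys (coeff p i))"
      by (auto simp: in_keys_iff intro!: bexI[of _ i])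
  qed
qed simp

lemma xs_monoms_0 [simp]: "xs_monoms 0 = {}"
  by (simp add: xs_monoms_def)

lemma xs_monoms_coeff_nonzero:
  assumes "coeff p i \<noteq> 0"
  obtains \<alpha> where "(\<alpha>, i) \<in> xs_monoms p"
proof -
  obtain \<alpha> where "Poly_Mapping.lookup (coeff p i) \<alpha> \<noteq> 0"
    using assms by (metis lookup_zero poly_mapping_eqI)
  then show thesis using that by (auto simp: xs_monoms_def)
qed

lemma xs_monoms_eq_empty_iff: "xs_monoms p = {} \<longleftrightarrow> p = 0"
proof
  assume "xs_monoms p = {}"
  then show "p = 0"
    using xs_monoms_coeff_nonzero[of p "degree p"] leading_coeff_0_iff[of p] by blast
qed simp

lemma xs_monoms_add: "xs_monoms (p + q) \<subseteq> xs_monoms p \<union> xs_monoms q"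
  by (auto simp: xs_monoms_def lookup_add)

lemma xs_monoms_diff: "xs_monoms (p - q) \<subseteq> xs_monoms p \<union> xs_monoms q"
  by (auto simp: xs_monoms_def lookup_minus)

lemma xs_monoms_mult: "xs_monoms (p * q) \<subseteq> {u + v | u v. u \<in> xs_monoms p \<and> v \<in> xs_monoms q}"
proof
  fix m assume "m \<in> xs_monoms (p * q)"
  then obtain \<alpha> i where m: "m = (\<alpha>, i)" "Poly_Mapping.lookup (coeff (p * q) i) \<alpha> \<noteq> 0"
    by (auto simp: xs_monoms_def)
  then have "(\<Sum>j\<le>i. Poly_Mapping.lookup (coeff p j * coeff q (i - j)) \<alpha>) \<noteq> 0"
    by (simp add: coeff_mult lookup_sum)
  then obtain j where j: "j \<le> i" "Poly_Mapping.lookup (coeff p j * coeff q (i - j)) \<alpha> \<noteq> 0"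
    by (metis (mono_tags, lifting) atMost_iff sum.neutral)
  then obtain \<beta> \<gamma> where "\<alpha> = \<beta> + \<gamma>" "\<beta> \<in> Poly_Mapping.keys (coeff p j)"
    "\<gamma> \<in> Poly_Mapping.keys (coeff q (i - j))"
    using keys_mult[of "coeff p j" "coeff q (i - j)"] by (auto simp: in_keys_iff)
  then show "m \<in> {u + v | u v. u \<in> xs_monoms p \<and> v \<in> xs_monoms q}"
    using m(1) j(1) unfolding xs_monoms_def
    by (intro CollectI exI[of _ "(\<beta>, j)"] exI[of _ "(\<gamma>, i - j)"]) (auto simp: in_keys_iff)
qed

lemma xs_monoms_monom: "c \<noteq> 0 \<Longrightarrow> xs_monoms (monom (Poly_Mapping.single \<gamma> c) j) = {(\<gamma>, j)}"
  by (auto simp: xs_monoms_def lookup_single when_def split: if_splits)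

abbreviation xs_coeff :: "('k::comm_ring_1, 'n) mpoly poly \<Rightarrow> 'n xs_monom \<Rightarrow> 'k"
  where "xs_coeff p m \<equiv> Poly_Mapping.lookup (coeff p (snd m)) (fst m)"

lemma in_xs_monoms_iff: "m \<in> xs_monoms p \<longleftrightarrow> xs_coeff p m \<noteq> 0"
  by (cases m) (simp add: xs_monoms_def)

lemma xs_coeff_monom_times:
  "xs_coeff (monom (Poly_Mapping.single \<gamma> c) j * p) ((\<gamma>, j) + m) = c * xs_coeff p m"
  by (cases m) (simp add: coeff_monom_mult lookup_single_times)

locale elimination_order =
  fixes r :: "'n xs_monom rel"
  assumes order: "monomial_order r" and elim: "eliminates_s r"
begin

lemma r_props: "refl_on UNIV r" "trans r" "antisym r" "total_on UNIV r" "wf (r - Id)"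
  using order
  unfolding monomial_order_def well_order_on_def linear_order_on_def partial_order_on_def preorder_on_def
  by blast+

lemmas r_wf = r_props(5)
  and r_antisym = antisymD[OF r_props(3)]
  and r_trans = transD[OF r_props(2)]

lemma r_refl: "(m, m) \<in> r"
  using r_props(1) by (rule refl_onD) simp

lemma r_total: "(m, m') \<in> r \<or> (m', m) \<in> r"
  using r_props(4) r_refl[of m] unfolding total_on_def by (cases "m = m'") blast+

lemma r_add: "(m, m') \<in> r \<Longrightarrow> (m + w, m' + w) \<in> r"
  using order unfolding monomial_order_def by blast

text \<open>Adding a power of \<open>s\<close> to both monomials makes the elimination property compare \<open>s\<close>-degrees.\<close>

lemma r_degree:
  assumes "i < j"
  shows "((\<alpha>, i), (\<beta>, j)) \<in> r"
proof -
  have "((\<alpha>, 0), (\<beta>, j - i)) \<in> r" using elim assms by (simp add: eliminates_s_def)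
  then show ?thesis using r_add[of "(\<alpha>, 0)" "(\<beta>, j - i)" "(0, i)"] assms by simp
qed

lemma leading_monom_props:
  assumes "p \<noteq> 0"
  shows "leading_monom r p \<in> xs_monoms p" "\<And>m. m \<in> xs_monoms p \<Longrightarrow> (m, leading_monom r p) \<in> r"
proof -
  have "\<exists>m\<in>M. \<forall>m'\<in>M. (m', m) \<in> r" if "finite M" "M \<noteq> {}" for M
    using that
  proof (induction M rule: finite_ne_induct)
    case (singleton m)
    then show ?case by (simp add: r_refl)
  next
    case (insert m M)
    then obtain m' where m': "m' \<in> M" "\<forall>m''\<in>M. (m'', m') \<in> r" by blast
    then show ?case using r_total[of m m'] r_refl r_trans by (metis insert_iff)
  qed
  then obtain m where m: "m \<in> xs_monoms p" "\<forall>m'\<in>xs_monoms p. (m', m) \<in> r"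
    using assms xs_monoms_eq_empty_iff finite_xs_monoms by metis
  have "leading_monom r p = m"
    unfolding leading_monom_def using m r_antisym by (intro the_equality) blast+
  then show "leading_monom r p \<in> xs_monoms p" "\<And>m. m \<in> xs_monoms p \<Longrightarrow> (m, leading_monom r p) \<in> r"
    using m by blast+
qed

lemma leading_monom_degree:
  assumes "p \<noteq> 0"
  shows "snd (leading_monom r p) = degree p"
proof -
  obtain \<alpha> i where lm: "leading_monom r p = (\<alpha>, i)" by (cases "leading_monom r p")
  then have "(\<alpha>, i) \<in> xs_monoms p" using leading_monom_props(1)[OF assms] by simp
  then have "coeff p i \<noteq> 0" by (auto simp: xs_monoms_def)
  then have "i \<le> degree p" by (rule le_degree)
  moreover have False if "i < degree p"
  proof -
    obtain \<beta> where "(\<beta>, degree p) \<in> xs_monoms p"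
      using xs_monoms_coeff_nonzero[of p "degree p"] assms leading_coeff_0_iff[of p] by blast
    then have "((\<beta>, degree p), (\<alpha>, i)) \<in> r" using leading_monom_props(2)[OF assms] lm by metis
    then show False using r_antisym[OF _ r_degree[OF that]] that by blast
  qed
  ultimately show ?thesis using lm by (auto simp: le_less)
qed

lemma leading_term_nonzero:
  "p \<noteq> 0 \<Longrightarrow> leading_term r p =
     monom (Poly_Mapping.single (fst (leading_monom r p)) (xs_coeff p (leading_monom r p))) (snd (leading_monom r p))"
  by (simp add: leading_term_def case_prod_unfold Let_def)

lemma xs_monoms_leading_term: "p \<noteq> 0 \<Longrightarrow> xs_monoms (leading_term r p) = {leading_monom r p}"
  using leading_monom_props(1)[of p]
  by (simp add: leading_term_nonzero xs_monoms_monom in_xs_monoms_iff)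

text \<open>
  In the ideal generated by monomials every monomial is a multiple of a generator.
\<close>

lemma groebner_basis_divides:
  fixes G1 I :: "('k::comm_ring_1, 'n) mpoly poly set"
  assumes G: "groebner_basis r G1 I" and p: "p \<in> I" "p \<noteq> 0"
  obtains g w where "g \<in> G1" "g \<noteq> 0" "leading_monom r p = w + leading_monom r g"
proof -
  define L :: "('k, 'n) mpoly poly set"
    where "L = {q. \<forall>m\<in>xs_monoms q. \<exists>g\<in>G1. g \<noteq> 0 \<and> (\<exists>w. m = w + leading_monom r g)}"
  have "left_ideal L"
    unfolding left_ideal_def
  proof (intro conjI ballI allI)
    show "0 \<in> L" by (simp add: L_def)
    show "p + q \<in> L" if "p \<in> L" "q \<in> L" for p q
      using that xs_monoms_add[of p q] unfolding L_def by blast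
    show "p * q \<in> L" if q: "q \<in> L" for p q
      unfolding L_def
    proof safe
      fix a b assume "(a, b) \<in> xs_monoms (p * q)"
      then obtain u v where uv: "(a, b) = u + v" "v \<in> xs_monoms q"
        using xs_monoms_mult[of p q] by blast
      then obtain g w where "g \<in> G1" "g \<noteq> 0" "v = w + leading_monom r g"
        using q unfolding L_def by blast
      then show "\<exists>g\<in>G1. g \<noteq> 0 \<and> (\<exists>w. (a, b) = w + leading_monom r g)"
        using uv(1) by (metis add.assoc)
    qed
  qed
  moreover have "leading_term r g \<in> L" if "g \<in> G1" for g
  proof (cases "g = 0")
    case True
    then show ?thesis by (simp add: leading_term_def L_def)
  next
    case False
    have "\<exists>g'\<in>G1. g' \<noteq> 0 \<and> (\<exists>w. leading_monom r g = w + leading_monom r g')"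
      using that False by (intro bexI[of _ g] conjI exI[of _ 0]) simp_all
    then show ?thesis by (simp add: L_def xs_monoms_leading_term[OF False])
  qed
  ultimately have "left_ideal hull (leading_term r ` G1) \<subseteq> L"
    by (intro hull_minimal) auto
  moreover have "leading_term r p \<in> left_ideal hull (leading_term r ` G1)"
    using G p(1) unfolding groebner_basis_def by (auto intro: hull_inc)
  ultimately have "leading_term r p \<in> L" by blast
  then have "\<exists>g\<in>G1. g \<noteq> 0 \<and> (\<exists>w. leading_monom r p = w + leading_monom r g)"
    by (simp add: L_def xs_monoms_leading_term[OF p(2)])
  then show thesis by (elim bexE conjE exE) (rule that)
qed

text \<open>
  Since the order compares degrees in \<open>s\<close> first, the leading monomial of a polynomial has its full
  \<open>s\<close>-degree.  Division by the Groebner basis therefore subtracts only multiples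
  \<open>c x\<^sup>\<gamma> s\<^sup>j g\<close> with \<open>j + deg\<^sub>s g \<le> d\<close>.
\<close>

lemma groebner_basis_span:
  fixes G1 :: "('k::field, 'n) mpoly poly set"
  assumes I: "left_ideal I" and G: "groebner_basis r G1 I"
  assumes "p \<in> I" "degree p \<le> d"
  shows "p \<in> module.span smult {monom 1 i * g | i g. g \<in> G1 \<and> i + degree g \<le> d}"
    (is "p \<in> module.span smult ?G2")
proof -
  interpret P: module "smult :: ('k, 'n) mpoly \<Rightarrow> _"
    by unfold_locales (simp_all add: smult_add_right smult_add_left)
  have "p \<in> I \<longrightarrow> p \<noteq> 0 \<longrightarrow> degree p \<le> d \<longrightarrow> leading_monom r p = m \<longrightarrow> p \<in> P.span ?G2" for p m
  proof (induction m arbitrary: p rule: wf_induct_rule[OF r_wf])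
    case (1 m)
    show ?case
    proof (intro impI)
      assume p: "p \<in> I" "p \<noteq> 0" "degree p \<le> d" "leading_monom r p = m"
      obtain g w where g: "g \<in> G1" "g \<noteq> 0" "m = w + leading_monom r g"
        using groebner_basis_divides[OF G p(1,2)] p(4) by metis
      obtain \<gamma> j where w: "w = (\<gamma>, j)" by (cases w)
      define c where "c = xs_coeff p m / xs_coeff g (leading_monom r g)"
      define q where "q = monom (Poly_Mapping.single \<gamma> c) j * g"
      have lc: "xs_coeff g (leading_monom r g) \<noteq> 0" "xs_coeff p m \<noteq> 0"
        using leading_monom_props(1) g(2) p(2,4) in_xs_monoms_iff by blast+
      then have "c \<noteq> 0" by (simp add: c_def)
      have degree: "j + degree g \<le> d"
        using arg_cong[OF g(3), of snd] leading_monom_degree[OF g(2)] leading_monom_degree[OF p(2)] p(3,4)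
        by (simp add: w)
      have monoms_q: "(m', m) \<in> r" if "m' \<in> xs_monoms q" for m'
      proof -
        from subsetD[OF xs_monoms_mult that[unfolded q_def]]
        obtain u v where uv: "m' = u + v" "v \<in> xs_monoms g" "u \<in> {w}"
          unfolding xs_monoms_monom[OF \<open>c \<noteq> 0\<close>] w by blast
        have "(v + w, leading_monom r g + w) \<in> r"
          using leading_monom_props(2)[OF g(2) uv(2)] by (rule r_add)
        moreover have "m' = v + w" using uv by (simp only: singleton_iff add.commute)
        moreover have "m = leading_monom r g + w" using g(3) by (simp only: add.commute)
        ultimately show ?thesis by (simp only:)
      qed
      have "xs_coeff q m = xs_coeff p m"
        unfolding q_def g(3) w xs_coeff_monom_times using lc by (simp add: c_def g(3) w)
      then have "m \<notin> xs_monoms (p - q)"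
        by (simp add: in_xs_monoms_iff lookup_minus)
      moreover have "(m', m) \<in> r" if "m' \<in> xs_monoms (p - q)" for m'
        using that xs_monoms_diff[of p q] monoms_q leading_monom_props(2)[OF p(2)] p(4) by blast
      ultimately have lower: "(leading_monom r (p - q), m) \<in> r - Id" if "p - q \<noteq> 0"
        using leading_monom_props(1)[OF that] by auto
      have q_eq: "q = smult (Poly_Mapping.single \<gamma> c) (monom 1 j * g)"
        by (simp add: q_def smult_monom flip: mult_smult_left)
      have "g \<in> I" using G g(1) by (auto simp: groebner_basis_def)
      then have "p - q \<in> I"
        unfolding q_def using I p(1) by (intro left_ideal_diff left_ideal_times)
      moreover have "degree (p - q) \<le> d"
      proof -
        have "degree q \<le> j + degree g"
          unfolding q_def by (rule order_trans[OF degree_mult_le]) (simp add: degree_monom_le)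
        then show ?thesis using degree p(3) by (intro degree_diff_le) auto
      qed
      ultimately have "p - q \<in> P.span ?G2"
        using 1[OF lower] by (cases "p - q = 0") (auto intro: P.span_zero)
      moreover have "q \<in> P.span ?G2"
        unfolding q_eq using g(1) degree by (intro P.span_scale P.span_base) blast
      ultimately show "p \<in> P.span ?G2"
        using P.span_add[of "p - q" ?G2 q] by simp
    qed
  qed
  then show ?thesis using assms(3,4) by (cases "p = 0") (auto intro: P.span_zero)
qed

text \<open>Being the last entry of a syzygy is membership in an ideal.\<close>

lemma groebner_basis_syzygy:
  fixes G1 :: "('k::field, 'n) mpoly poly set"
  assumes I: "left_ideal I" and G: "groebner_basis r G1 I"
    and G2: "G2 = {monom 1 i * g | i g. g \<in> G1 \<and> i + degree g \<le> d}" and h: "degree h \<le> d"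
  shows "(\<exists>u\<in>extensional G2. (\<Sum>g\<in>G2. smult (u g) g) + smult c h = 0) \<longleftrightarrow> smult c h \<in> I"
proof
  have G2_I: "g \<in> I" if "g \<in> G2" for g
    using that G I left_ideal_times unfolding G2 groebner_basis_def by blast
  {
    assume "\<exists>u\<in>extensional G2. (\<Sum>g\<in>G2. smult (u g) g) + smult c h = 0"
    then obtain u where "(\<Sum>g\<in>G2. smult (u g) g) + smult c h = 0" by blast
    then have "smult c h = - (\<Sum>g\<in>G2. [:u g:] * g)"
      by (simp add: eq_neg_iff_add_eq_0 add.commute)
    also have "\<dots> \<in> I"
      using I G2_I by (intro left_ideal_uminus left_ideal_sum left_ideal_times)
    finally show "smult c h \<in> I" .
  }
  assume ch: "smult c h \<in> I"
  interpret P: module "smult :: ('k, 'n) mpoly \<Rightarrow> _"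
    by unfold_locales (simp_all add: smult_add_right smult_add_left)
  have "finite G1" using G by (simp add: groebner_basis_def)
  moreover have "G2 \<subseteq> (\<lambda>(i, g). monom 1 i * g) ` ({..d} \<times> G1)" unfolding G2 by force
  ultimately have "finite G2" by (meson finite_SigmaI finite_atMost finite_imageI finite_subset)
  have "smult c h \<in> P.span G2"
    unfolding G2 using I G ch order_trans[OF degree_smult_le h] by (rule groebner_basis_span)
  then obtain u where u: "smult c h = (\<Sum>g\<in>G2. smult (u g) g)"
    unfolding P.span_finite[OF \<open>finite G2\<close>] by blast
  have "(\<Sum>g\<in>G2. smult (restrict (\<lambda>g. - u g) G2 g) g) + smult c h = 0"
    unfolding u sum.distrib[symmetric] by (rule sum.neutral) simp
  then show "\<exists>u\<in>extensional G2. (\<Sum>g\<in>G2. smult (u g) g) + smult c h = 0"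
    using restrict_extensional by blast
qed

end

section \<open>Divisibility by the local Bernstein--Sato polynomial\<close>

theorem mainTheorem2:
  fixes f :: "('k::field_char_0, 'n::{finite,linorder}) mpoly"
    and b :: "rat poly"
    and d :: nat
    and r :: "'n xs_monom rel"
    and G G1 G2 :: "('k, 'n) mpoly poly set"
    and bx :: "('k, 'n) mpoly poly"
    and \<phi> :: "(('k, 'n) mpoly poly \<Rightarrow> ('k, 'n) mpoly) \<times> ('k, 'n) mpoly \<Rightarrow> ('k, 'n) mpoly poly"
    and S :: "((('k, 'n) mpoly poly \<Rightarrow> ('k, 'n) mpoly) \<times> ('k, 'n) mpoly) set"
    and E P :: "('k, 'n) mpoly set"
  assumes "f \<noteq> 0" and "b \<noteq> 0"
    and "left_ideal hull G = {p. Kxs_to_DY p \<in> initial_ideal w_t (I_f f)}"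
    and "monomial_order r" and "eliminates_s r"
    and "groebner_basis r G1 (left_ideal hull G)"
    and "d = degree b"
    and "G2 = {monom 1 i * g | i g. g \<in> G1 \<and> i + degree g \<le> d}"
    and "bx = map_poly (\<lambda>c. Poly_Mapping.single 0 (of_rat c)) b"
    and "\<phi> = (\<lambda>(u, c). (\<Sum>g\<in>G2. smult (u g) g) + smult c bx)"
    and "S = {(u, c) \<in> extensional G2 \<times> UNIV. \<phi> (u, c) = 0}"
    and "E = snd ` S"
    and "prime_ideal P"
  shows "local_bs_poly f P dvd map_poly of_rat b \<longleftrightarrow> \<not> E \<subseteq> P"
proof -
  interpret nonzero_polynomial_at_prime f P
    using assms(1,13) by unfold_locales
  interpret elimination_order r
    using assms(4,5) by unfold_locales
  let ?b = "map_poly of_rat b :: 'k poly"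
  have bx: "bx = map_poly (Poly_Mapping.single 0) ?b"
    by (rule poly_eqI) (simp add: assms(9) coeff_map_poly)
  have "degree bx \<le> d"
    unfolding assms(7,9) by (rule map_poly_degree_leq)
  then have "c \<in> E \<longleftrightarrow> Kxs_to_DY (smult c bx) \<in> initial_ideal w_t (I_f f)" for c
    using groebner_basis_syzygy[OF left_ideal_hull assms(6,8), of bx c]
    by (auto simp: assms(3,10-12) image_iff)
  then have "\<not> E \<subseteq> P \<longleftrightarrow> local_functional_equation f P ?b"
    unfolding local_functional_equation_iff_in_initial_ideal bx by blast
  moreover have "?b \<noteq> 0"
    using assms(2) by (simp add: map_poly_eq_0_iff)
  ultimately show ?thesis using local_bs_poly_dvd_iff by simp
qed

end
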